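(* Let $n\ge2$. The Boolean completion $C_n=\mathsf{D}(P_n)$ of the polycyclic inverse monoid $P_n$ (called the Cuntz inverse monoid) is congruence-free, and its group of units is (isomorphic to) the Thompson group $G_{n,1}$.
   Context: Polycyclic monoid. For $n\ge2$, $P_n$ is the monoid with zero presented by $\langle a_1,\ldots,a_n,a_1^{-1},\ldots,a_n^{-1} : a_i^{-1}a_i=1,\ a_i^{-1}a_j=0\ (i\neq j)\rangle$. Its non-zero elements are uniquely of the form $yx^{-1}$ with $x,y\in A^*$, the free monoid on $A=\{a_1,\ldots,a_n\}$; $yx^{-1}\cdot vu^{-1}$ equals $yzu^{-1}$ if $v=xz$, equals $y(uz)^{-1}$ if $x=vz$, and is $0$ otherwise. It is an inverse monoid in which each pair of elements has a meet in the natural partial order ($s\le t$ iff $s=te$ for some idempotent $e$). Distributive completion. Let $S$ be an inverse semigroup with zero in which all pairs have meets in the natural partial order. Elements $s,t$ are compatible if $s^{-1}t$ and $st^{-1}$ are idempotents. Write $\{a_1,\ldots,a_m\}\rightarrow\{b_1,\ldots,b_k\}$ if for each $i$ and each non-zero $x\le a_i$ there is $j$ with $x\wedge b_j\ne0$; $\leftrightarrow$ means both directions. On elements, $\leftrightarrow$ is a congruence on $S$; put $\mathbf{S}=S/\!\leftrightarrow$. Let $\mathsf{FC}(\mathbf{S})$ be the inverse semigroup, under multiplication of subsets, of all order ideals $\{a_1,\ldots,a_m\}^{\downarrow}$ of $\mathbf{S}$ generated by non-empty finite pairwise compatible subsets. Define $\{a_1,\ldots,a_m\}^\downarrow\equiv\{b_1,\ldots,b_k\}^\downarrow$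 iff $\{a_1,\ldots,a_m\}\leftrightarrow\{b_1,\ldots,b_k\}$ in $\mathbf{S}$, a congruence. Then $\mathsf{D}(S)=\mathsf{FC}(\mathbf{S})/\!\equiv$. $S$ is pre-Boolean if the idempotents of $\mathsf{D}(S)$ form a generalized Boolean algebra (distributive lattice with $0$ and relative complements), and then $\mathsf{D}(S)$ is called the Boolean completion of $S$. $P_n$ is pre-Boolean. Congruence-free means that the only congruences are equality and the universal congruence. Thompson group $G_{n,1}$. Let $A^*$ act on itself by right multiplication. A right ideal of $A^*$ is finitely generated if it is a finite union of sets $pA^*$, and essential if it intersects every non-empty right ideal. The isomorphisms of right $A^*$-acts between finitely generated essential right ideals form an inverse monoid under composition of partial maps, in which each element is a restriction of a unique maximal element. $G_{n,1}$ is the group of maximal such isomorphisms, the product of $f$ and $g$ being the unique maximal isomorphism extending $fg$ (equivalently, the maximum group image of this inverse monoid). *)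

theory Defs
  imports "HOL-Algebra.Coset"
begin

text \<open>
  Semigroups are represented by HOL-Algebra monoid records. For a semigroup without identity
  the \<open>one\<close> component carries no meaning and is not used, except to transport it along
  quotients and completions.
\<close>

section \<open>Congruences, quotients and presentations\<close>

definition semigroup_congruence :: "('a, 'm) monoid_scheme \<Rightarrow> ('a \<times> 'a) set \<Rightarrow> bool" where
  "semigroup_congruence S r \<longleftrightarrow>
     equiv (carrier S) r \<and>
     (\<forall>(a, b) \<in> r. \<forall>(c, d) \<in> r. (a \<otimes>\<^bsub>S\<^esub> c, b \<otimes>\<^bsub>S\<^esub> d) \<in> r)"

definition congruence_free :: "('a, 'm) monoid_scheme \<Rightarrow> bool" where
  "congruence_free S \<longleftrightarrow>
     (\<forall>r. semigroup_congruence S r \<longrightarrow> r = Id_on (carrier S) \<or> r = carrier S \<times> carrier S)"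

text \<open>Multiplication of classes is independent of representatives when \<open>r\<close> is a congruence,
  so that the union below is over copies of a single class.\<close>

definition quotient_semigroup :: "('a, 'm) monoid_scheme \<Rightarrow> ('a \<times> 'a) set \<Rightarrow> 'a set monoid" where
  "quotient_semigroup S r =
     \<lparr>carrier = carrier S // r,
      mult = (\<lambda>X Y. \<Union>x\<in>X. \<Union>y\<in>Y. r `` {x \<otimes>\<^bsub>S\<^esub> y}),
      one = r `` {\<one>\<^bsub>S\<^esub>}\<rparr>"

definition generated_congruence ::
    "('a, 'm) monoid_scheme \<Rightarrow> ('a \<times> 'a) set \<Rightarrow> ('a \<times> 'a) set" where
  "generated_congruence S R = \<Inter>{r. semigroup_congruence S r \<and> R \<subseteq> r}"

section \<open>The polycyclic monoid\<close>

text \<open>The letter \<open>Gen i\<close> stands for $a_i$ and \<open>GenInv i\<close> for $a_i^{-1}$;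
  the indices range over \<open>i < n\<close>.\<close>

datatype letter = Gen nat | GenInv nat

text \<open>The free monoid with zero on the letters; \<open>None\<close> is the zero.\<close>

definition free_monoid_zero :: "nat \<Rightarrow> letter list option monoid" where
  "free_monoid_zero n =
     \<lparr>carrier = insert None (Some ` lists (Gen ` {..<n} \<union> GenInv ` {..<n})),
      mult = (\<lambda>u v. case (u, v) of (Some x, Some y) \<Rightarrow> Some (x @ y) | _ \<Rightarrow> None),
      one = Some []\<rparr>"

definition polycyclic_relations :: "nat \<Rightarrow> (letter list option \<times> letter list option) set" where
  "polycyclic_relations n =
     {(Some [GenInv i, Gen i], Some []) | i. i < n} \<union>
     {(Some [GenInv i, Gen j], None) | i j. i < n \<and> j < n \<and> i \<noteq> j}"

definition polycyclic_monoid :: "nat \<Rightarrow> letter list option set monoid" where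
  "polycyclic_monoid n =
     quotient_semigroup (free_monoid_zero n)
       (generated_congruence (free_monoid_zero n) (polycyclic_relations n))"

section \<open>Inverse semigroups with zero\<close>

text \<open>The descriptions below are unique in an inverse semigroup with zero in which all pairs
  of elements have meets.\<close>

definition sg_zero :: "('a, 'm) monoid_scheme \<Rightarrow> 'a" where
  "sg_zero S = (THE z. z \<in> carrier S \<and> (\<forall>x \<in> carrier S. z \<otimes>\<^bsub>S\<^esub> x = z \<and> x \<otimes>\<^bsub>S\<^esub> z = z))"

definition sg_inverse :: "('a, 'm) monoid_scheme \<Rightarrow> 'a \<Rightarrow> 'a" where
  "sg_inverse S x =
     (THE y. y \<in> carrier S \<and> x \<otimes>\<^bsub>S\<^esub> y \<otimes>\<^bsub>S\<^esub> x = x \<and> y \<otimes>\<^bsub>S\<^esub> x \<otimes>\<^bsub>S\<^esub> y = y)"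

definition idempotents :: "('a, 'm) monoid_scheme \<Rightarrow> 'a set" where
  "idempotents S = {e \<in> carrier S. e \<otimes>\<^bsub>S\<^esub> e = e}"

definition natural_le :: "('a, 'm) monoid_scheme \<Rightarrow> 'a \<Rightarrow> 'a \<Rightarrow> bool" where
  "natural_le S s t \<longleftrightarrow>
     s \<in> carrier S \<and> t \<in> carrier S \<and> (\<exists>e \<in> idempotents S. s = t \<otimes>\<^bsub>S\<^esub> e)"

definition natural_meet :: "('a, 'm) monoid_scheme \<Rightarrow> 'a \<Rightarrow> 'a \<Rightarrow> 'a" where
  "natural_meet S s t =
     (THE m. natural_le S m s \<and> natural_le S m t \<and>
        (\<forall>x. natural_le S x s \<and> natural_le S x t \<longrightarrow> natural_le S x m))"

definition sg_compatible :: "('a, 'm) monoid_scheme \<Rightarrow> 'a \<Rightarrow> 'a \<Rightarrow> bool" where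
  "sg_compatible S s t \<longleftrightarrow>
     sg_inverse S s \<otimes>\<^bsub>S\<^esub> t \<in> idempotents S \<and> s \<otimes>\<^bsub>S\<^esub> sg_inverse S t \<in> idempotents S"

section \<open>The distributive completion\<close>

definition arrow :: "('a, 'm) monoid_scheme \<Rightarrow> 'a set \<Rightarrow> 'a set \<Rightarrow> bool" where
  "arrow S A B \<longleftrightarrow>
     (\<forall>a \<in> A. \<forall>x. natural_le S x a \<and> x \<noteq> sg_zero S \<longrightarrow>
        (\<exists>b \<in> B. natural_meet S x b \<noteq> sg_zero S))"

definition biarrow :: "('a, 'm) monoid_scheme \<Rightarrow> 'a set \<Rightarrow> 'a set \<Rightarrow> bool" where
  "biarrow S A B \<longleftrightarrow> arrow S A B \<and> arrow S B A"

definition biarrow_rel :: "('a, 'm) monoid_scheme \<Rightarrow> ('a \<times> 'a) set" where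
  "biarrow_rel S = {(a, b). a \<in> carrier S \<and> b \<in> carrier S \<and> biarrow S {a} {b}}"

definition order_ideal :: "('a, 'm) monoid_scheme \<Rightarrow> 'a set \<Rightarrow> 'a set" where
  "order_ideal S A = {s. \<exists>a \<in> A. natural_le S s a}"

definition compatible_generators :: "('a, 'm) monoid_scheme \<Rightarrow> 'a set set" where
  "compatible_generators S =
     {A. A \<subseteq> carrier S \<and> finite A \<and> A \<noteq> {} \<and> (\<forall>a \<in> A. \<forall>b \<in> A. sg_compatible S a b)}"

text \<open>If \<open>S\<close> is a monoid, the order ideal generated by the identity is an identity for the
  multiplication of order ideals.\<close>

definition finitary_completion :: "('a, 'm) monoid_scheme \<Rightarrow> 'a set monoid" where
  "finitary_completion S =
     \<lparr>carrier = order_ideal S ` compatible_generators S,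
      mult = (\<lambda>I J. I <#>\<^bsub>S\<^esub> J),
      one = order_ideal S {\<one>\<^bsub>S\<^esub>}\<rparr>"

definition completion_rel :: "('a, 'm) monoid_scheme \<Rightarrow> ('a set \<times> 'a set) set" where
  "completion_rel S =
     {(order_ideal S A, order_ideal S B) | A B.
        A \<in> compatible_generators S \<and> B \<in> compatible_generators S \<and> biarrow S A B}"

definition distributive_completion :: "('a, 'm) monoid_scheme \<Rightarrow> 'a set set set monoid" where
  "distributive_completion S =
     (let T = quotient_semigroup S (biarrow_rel S)
      in quotient_semigroup (finitary_completion T) (completion_rel T))"

definition cuntz_monoid :: "nat \<Rightarrow> letter list option set set set set monoid" where
  "cuntz_monoid n = distributive_completion (polycyclic_monoid n)"

section \<open>The Thompson group\<close>

text \<open>The free monoid on \<open>n\<close> letters is \<open>lists {..<n}\<close>, with concatenation as product.\<close>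

definition right_ideal :: "nat \<Rightarrow> nat list set \<Rightarrow> bool" where
  "right_ideal n R \<longleftrightarrow>
     R \<subseteq> lists {..<n} \<and> (\<forall>r \<in> R. \<forall>w \<in> lists {..<n}. r @ w \<in> R)"

definition fg_right_ideal :: "nat \<Rightarrow> nat list set \<Rightarrow> bool" where
  "fg_right_ideal n R \<longleftrightarrow>
     (\<exists>P. finite P \<and> P \<subseteq> lists {..<n} \<and> R = (\<Union>p\<in>P. (\<lambda>w. p @ w) ` lists {..<n}))"

definition essential_right_ideal :: "nat \<Rightarrow> nat list set \<Rightarrow> bool" where
  "essential_right_ideal n R \<longleftrightarrow>
     right_ideal n R \<and> (\<forall>I. right_ideal n I \<and> I \<noteq> {} \<longrightarrow> R \<inter> I \<noteq> {})"

text \<open>Isomorphisms between right ideals are partial maps, so that \<open>\<circ>\<^sub>m\<close> is composition of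
  partial maps and \<open>\<subseteq>\<^sub>m\<close> is restriction.\<close>

definition ideal_isos :: "nat \<Rightarrow> (nat list \<rightharpoonup> nat list) set" where
  "ideal_isos n =
     {f. fg_right_ideal n (dom f) \<and> essential_right_ideal n (dom f) \<and>
         fg_right_ideal n (ran f) \<and> essential_right_ideal n (ran f) \<and>
         inj_on f (dom f) \<and>
         (\<forall>r \<in> dom f. \<forall>w \<in> lists {..<n}. f (r @ w) = Some (the (f r) @ w))}"

definition maximal_isos :: "nat \<Rightarrow> (nat list \<rightharpoonup> nat list) set" where
  "maximal_isos n = {f \<in> ideal_isos n. \<forall>g \<in> ideal_isos n. f \<subseteq>\<^sub>m g \<longrightarrow> g = f}"

definition thompson_group :: "nat \<Rightarrow> (nat list \<rightharpoonup> nat list) monoid" where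
  "thompson_group n =
     \<lparr>carrier = maximal_isos n,
      mult = (\<lambda>f g. THE h. h \<in> maximal_isos n \<and> (f \<circ>\<^sub>m g) \<subseteq>\<^sub>m h),
      one = (\<lambda>w. if w \<in> lists {..<n} then Some w else None)\<rparr>"

end

theory Submission
  imports Defs "HOL-Library.Sublist"
begin

text \<open>
  The element \<open>y x\<^sup>-\<^sup>1\<close> of the polycyclic monoid acts on words by the partial bijection
  \<open>x w \<mapsto> y w\<close>, and this action is faithful. A finite compatible set acts by the union of these
  graphs, a right-invariant partial bijection \<open>R\<close> of words. Let \<open>cl R\<close> consist of the pairs
  \<open>(y, x)\<close> such that every \<open>w\<close> extends to some \<open>w z\<close> with \<open>(y w z, x w z) \<in> R\<close>. Then
  \<open>A \<leftrightarrow> B\<close> holds iff the two relations have the same closure, so the Cuntz monoid is the monoid of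
  closed finitely generated partial bijections, with product \<open>cl (R O S)\<close>.

  Congruence-freeness: if \<open>a\<close> and \<open>b\<close> are congruent and distinct, some \<open>(y, x)\<close> in \<open>a\<close> has no
  extension in \<open>b\<close>; multiplying by \<open>y\<^sup>-\<^sup>1\<close> and \<open>x\<close> turns \<open>a\<close> into \<open>1\<close> and \<open>b\<close> into some \<open>c\<close>
  containing no pair \<open>(p, p)\<close>. Either \<open>c = 0\<close>, or \<open>c\<close> contains a pair \<open>(p, q)\<close> with \<open>p, q\<close>
  incomparable, and then multiplication by \<open>p\<^sup>-\<^sup>1\<close> and \<open>q\<close> turns \<open>1\<close> into \<open>0\<close> and \<open>c\<close> into \<open>1\<close>.

  Units: a finitely generated right ideal is essential iff it contains all sufficiently long words.
  Hence the graphs of maximal isomorphisms between such ideals are exactly the invertible closed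
  partial bijections.
\<close>

section \<open>Right-invariant relations on words\<close>

text \<open>\<open>Some (y, x)\<close> stands for \<open>y x\<^sup>-\<^sup>1\<close>, and \<open>None\<close> for \<open>0\<close>. Relations likewise list the
  output word first, so that relational composition is in the order of multiplication.\<close>

type_synonym pm = "(nat list \<times> nat list) option"

fun pmult :: "pm \<Rightarrow> pm \<Rightarrow> pm" where
  "pmult (Some (y, x)) (Some (v, u)) =
     (if prefix x v then Some (y @ drop (length x) v, u)
      else if prefix v x then Some (y, u @ drop (length v) x) else None)"
| "pmult _ _ = None"

lemma pmult_None [simp]: "pmult a None = None" "pmult None a = None"
  by (cases a; auto)+

definition pbij :: "('a \<times> 'b) set \<Rightarrow> bool" where
  "pbij R \<longleftrightarrow> single_valued R \<and> single_valued (R\<inverse>)"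

lemma pbij_iff: "pbij R \<longleftrightarrow> (\<forall>y x x'. (y, x) \<in> R \<longrightarrow> (y, x') \<in> R \<longrightarrow> x = x') \<and>
    (\<forall>y y' x. (y, x) \<in> R \<longrightarrow> (y', x) \<in> R \<longrightarrow> y = y')"
  unfolding pbij_def single_valued_def by blast

lemma pbij_comp: "pbij R \<Longrightarrow> pbij S \<Longrightarrow> pbij (R O S)"
  by (simp add: pbij_def single_valued_relcomp converse_relcomp)

text \<open>When \<open>(p, q) \<in> R\<close> factors through \<open>(p, r) \<in> R\<close>,
  \<open>(r, s) \<in> S\<close> and \<open>(s, q) \<in> R\<close>, bijectivity of \<open>R\<close>
  forces \<open>r = q\<close> and \<open>s = p\<close>. Applied with the roles of \<open>R\<close>
  and \<open>S\<close> exchanged as well, this gives uniqueness of inverses in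
  \<open>pinv_iff\<close>.\<close>

lemma pbij_subset_converse:
  assumes "pbij R" "R O S O R = R"
  shows "R \<subseteq> S\<inverse>"
proof clarify
  fix p q assume pq: "(p, q) \<in> R"
  then obtain r s where "(p, r) \<in> R" "(r, s) \<in> S" "(s, q) \<in> R" using assms(2) by blast
  then show "(q, p) \<in> S" using pq assms(1) unfolding pbij_iff by metis
qed

lemma pbij_comp_converse:
  assumes "pbij R"
  shows "R O R\<inverse> O R = R"
  using assms unfolding pbij_iff by fast

lemma pbij_converse: "pbij (R\<inverse>) \<longleftrightarrow> pbij R"
  unfolding pbij_def by auto

locale polycyclic =
  fixes n :: nat
  assumes n2: "2 \<le> n"
begin

declare in_lists_conv_set [simp del] in_listsD [rule del] in_listsI [rule del]

abbreviation W :: "nat list set" where "W \<equiv> lists {..<n}"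

definition gen :: "(nat list \<times> nat list) set \<Rightarrow> (nat list \<times> nat list) set" where
  "gen F = {(y @ w, x @ w) | y x w. (y, x) \<in> F \<and> w \<in> W}"

text \<open>For right-invariant \<open>R\<close> this is closure in the dense topology: a pair
  enters as soon as the words that push it into \<open>R\<close> are dense in the prefix
  order.\<close>

definition cl :: "(nat list \<times> nat list) set \<Rightarrow> (nat list \<times> nat list) set" where
  "cl R = {(y, x). y \<in> W \<and> x \<in> W \<and> (\<forall>w\<in>W. \<exists>z\<in>W. (y @ w @ z, x @ w @ z) \<in> R)}"

text \<open>These are the subacts of \<open>W \<times> W\<close> under diagonal right
  multiplication.\<close>

definition rideal :: "(nat list \<times> nat list) set \<Rightarrow> bool" where
  "rideal R \<longleftrightarrow> R \<subseteq> W \<times> W \<and> (\<forall>y x w. (y, x) \<in> R \<longrightarrow> w \<in> W \<longrightarrow> (y @ w, x @ w) \<in> R)"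

lemma rideal_W: "rideal R \<Longrightarrow> (y, x) \<in> R \<Longrightarrow> y \<in> W \<and> x \<in> W"
  unfolding rideal_def by blast

lemma rideal_app: "rideal R \<Longrightarrow> (y, x) \<in> R \<Longrightarrow> w \<in> W \<Longrightarrow> (y @ w, x @ w) \<in> R"
  unfolding rideal_def by blast

lemma genI: "(y, x) \<in> F \<Longrightarrow> w \<in> W \<Longrightarrow> (y @ w, x @ w) \<in> gen F"
  unfolding gen_def by blast

lemma genE:
  assumes "(v, u) \<in> gen F"
  obtains y x w where "(y, x) \<in> F" "w \<in> W" "v = y @ w" "u = x @ w"
  using assms unfolding gen_def by blast

lemma rideal_gen:
  assumes "F \<subseteq> W \<times> W"
  shows "rideal (gen F)"
  unfolding rideal_def
proof (intro conjI allI impI subrelI)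
  fix v u w assume "(v, u) \<in> gen F" "w \<in> W"
  then show "(v @ w, u @ w) \<in> gen F"
    using genI[of _ _ F "_ @ w"] by (auto elim!: genE)
qed (use assms in \<open>auto elim!: genE\<close>)

lemma gen_incl: "F \<subseteq> gen F"
  using genI[of _ _ F "[]"] by auto

lemma gen_least: "rideal R \<Longrightarrow> F \<subseteq> R \<Longrightarrow> gen F \<subseteq> R"
  unfolding gen_def rideal_def by blast

lemma gen_UN: "gen F = (\<Union>p\<in>F. gen {p})"
  unfolding gen_def by blast

lemma gen_converse: "gen (F\<inverse>) = (gen F)\<inverse>"
  unfolding gen_def by auto

section \<open>The closure operator\<close>

lemma rideal_cl: "rideal (cl R)"
  unfolding rideal_def
proof (intro conjI allI impI subrelI)
  fix v u w assume vu: "(v, u) \<in> cl R" and w: "w \<in> W"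
  show "(v @ w, u @ w) \<in> cl R"
    unfolding cl_def
  proof (clarify, intro conjI ballI)
    fix w' assume "w' \<in> W"
    then show "\<exists>z\<in>W. ((v @ w) @ w' @ z, (u @ w) @ w' @ z) \<in> R"
      using vu w unfolding cl_def by (auto dest!: bspec[of _ _ "w @ w'"])
  qed (use vu w in \<open>auto simp: cl_def\<close>)
qed (auto simp: cl_def)

lemma cl_mono: "R \<subseteq> S \<Longrightarrow> cl R \<subseteq> cl S"
  unfolding cl_def by blast

lemma clI: "y \<in> W \<Longrightarrow> x \<in> W \<Longrightarrow> (\<And>w. w \<in> W \<Longrightarrow> \<exists>z\<in>W. (y @ w @ z, x @ w @ z) \<in> R) \<Longrightarrow> (y, x) \<in> cl R"
  unfolding cl_def by blast

lemma cl_incl: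
  assumes "rideal R"
  shows "R \<subseteq> cl R"
proof
  fix p assume "p \<in> R"
  then show "p \<in> cl R" using rideal_W[OF assms] rideal_app[OF assms]
    by (cases p) (auto intro!: clI bexI[of _ "[]"])
qed

lemma clD: "(y, x) \<in> cl R \<Longrightarrow> w \<in> W \<Longrightarrow> \<exists>z\<in>W. (y @ w @ z, x @ w @ z) \<in> R"
  unfolding cl_def by blast

lemma clD0: "(y, x) \<in> cl R \<Longrightarrow> \<exists>z\<in>W. (y @ z, x @ z) \<in> R"
  using clD[of y x R "[]"] by simp

lemma clW: "(y, x) \<in> cl R \<Longrightarrow> y \<in> W \<and> x \<in> W"
  unfolding cl_def by blast

lemma cl_idem: "cl (cl R) = cl R"
proof
  show "cl (cl R) \<subseteq> cl R"
  proof (clarify, rule clI)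
    fix y x w assume yx: "(y, x) \<in> cl (cl R)" and w: "w \<in> W"
    obtain z where z: "z \<in> W" "(y @ w @ z, x @ w @ z) \<in> cl R" using clD[OF yx w] by blast
    then obtain z' where "z' \<in> W" "(y @ w @ z @ z', x @ w @ z @ z') \<in> R" using clD0[OF z(2)] by auto
    with z show "\<exists>z\<in>W. (y @ w @ z, x @ w @ z) \<in> R" by (intro bexI[of _ "z @ z'"]) auto
  qed (auto dest: clW)
  show "cl R \<subseteq> cl (cl R)" by (rule cl_incl[OF rideal_cl])
qed

lemma cl_subset_iff: "rideal R \<Longrightarrow> cl R \<subseteq> cl S \<longleftrightarrow> R \<subseteq> cl S"
  using cl_incl cl_mono[of R "cl S"] by (auto simp: cl_idem)

text \<open>The quantifier over \<open>w\<close> in \<open>cl\<close> disappears because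
  \<open>(y @ w, x @ w)\<close> is itself a member of the right-invariant relation
  \<open>R\<close>.\<close>

lemma subset_cl_iff:
  assumes "rideal R"
  shows "R \<subseteq> cl S \<longleftrightarrow> (\<forall>(y, x)\<in>R. \<exists>z\<in>W. (y @ z, x @ z) \<in> S)"
proof
  assume *: "\<forall>(y, x)\<in>R. \<exists>z\<in>W. (y @ z, x @ z) \<in> S"
  show "R \<subseteq> cl S"
  proof (clarify, rule clI)
    fix y x w assume "(y, x) \<in> R" "w \<in> W"
    then have "(y @ w, x @ w) \<in> R" by (rule rideal_app[OF assms])
    with * show "\<exists>z\<in>W. (y @ w @ z, x @ w @ z) \<in> S" by fastforce
  qed (auto dest: rideal_W[OF assms])
qed (auto dest!: clD0)

lemma rideal_comp: "rideal R \<Longrightarrow> rideal S \<Longrightarrow> rideal (R O S)"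
  unfolding rideal_def[of "R O S"] by (auto dest: rideal_W intro: relcompI rideal_app)

lemma rideal_converse: "rideal R \<Longrightarrow> rideal (R\<inverse>)"
  unfolding rideal_def by auto

text \<open>A first extension moves the left pair into \<open>R\<close>, a second one moves the
  right pair into \<open>S\<close>, and right-invariance keeps the left pair in \<open>R\<close>
  meanwhile. Inner closures can therefore be dropped, which makes \<open>cl (R O S)\<close> an
  associative product on closed relations.\<close>

lemma cl_comp:
  assumes "rideal R" "rideal S"
  shows "cl (cl R O cl S) = cl (R O S)"
proof
  have "cl R O cl S \<subseteq> cl (R O S)"
  proof (clarify, rule clI)
    fix y x u w assume yx: "(y, x) \<in> cl R" and "(x, u) \<in> cl S" and "w \<in> W"
    obtain z where z: "z \<in> W" "(y @ w @ z, x @ w @ z) \<in> R" using clD[OF yx \<open>w \<in> W\<close>] by blast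
    then obtain z' where z': "z' \<in> W" "(x @ w @ z @ z', u @ w @ z @ z') \<in> S"
      using clD[OF \<open>(x, u) \<in> cl S\<close>, of "w @ z"] \<open>w \<in> W\<close> by auto
    have "(y @ w @ z @ z', x @ w @ z @ z') \<in> R" using rideal_app[OF assms(1) z(2) z'(1)] by simp
    with z z' show "\<exists>z\<in>W. (y @ w @ z, u @ w @ z) \<in> R O S"
      by (intro bexI[of _ "z @ z'"] relcompI) auto
  qed (auto dest: clW)
  then show "cl (cl R O cl S) \<subseteq> cl (R O S)" using cl_mono cl_idem by blast
  show "cl (R O S) \<subseteq> cl (cl R O cl S)" by (intro cl_mono relcomp_mono cl_incl assms)
qed

text \<open>Two pairs sharing a component are extended by the same word until both lie in
  \<open>R\<close>; bijectivity of \<open>R\<close> applies there, and the common suffix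
  cancels.\<close>

lemma pbij_cl:
  assumes "pbij R" "rideal R"
  shows "pbij (cl R)"
  unfolding pbij_iff
proof (intro conjI allI impI)
  fix y x x' assume a: "(y, x) \<in> cl R" "(y, x') \<in> cl R"
  obtain z where z: "z \<in> W" "(y @ z, x @ z) \<in> R" using clD0[OF a(1)] by blast
  obtain z' where z': "z' \<in> W" "(y @ z @ z', x' @ z @ z') \<in> R" using clD[OF a(2) z(1)] by blast
  have "(y @ z @ z', x @ z @ z') \<in> R" using rideal_app[OF assms(2) z(2) z'(1)] by simp
  then have "x @ z @ z' = x' @ z @ z'" using z'(2) assms(1) unfolding pbij_iff by blast
  then show "x = x'" by simp
next
  fix y y' x assume a: "(y, x) \<in> cl R" "(y', x) \<in> cl R"
  obtain z where z: "z \<in> W" "(y @ z, x @ z) \<in> R" using clD0[OF a(1)] by blast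
  obtain z' where z': "z' \<in> W" "(y' @ z @ z', x @ z @ z') \<in> R" using clD[OF a(2) z(1)] by blast
  have "(y @ z @ z', x @ z @ z') \<in> R" using rideal_app[OF assms(2) z(2) z'(1)] by simp
  then have "y @ z @ z' = y' @ z @ z'" using z'(2) assms(1) unfolding pbij_iff by blast
  then show "y = y'" by simp
qed

section \<open>The action of the polycyclic monoid\<close>

definition PM :: "pm set" where "PM = insert None (Some ` (W \<times> W))"

definition rel :: "pm \<Rightarrow> (nat list \<times> nat list) set" where
  "rel a = (case a of None \<Rightarrow> {} | Some p \<Rightarrow> gen {p})"

lemma rel_None [simp]: "rel None = {}" by (simp add: rel_def)

lemma mem_gen1: "(v, u) \<in> gen {(y, x)} \<longleftrightarrow> (\<exists>w\<in>W. v = y @ w \<and> u = x @ w)"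
  unfolding gen_def by auto

lemma mem_rel: "(v, u) \<in> rel (Some (y, x)) \<longleftrightarrow> (\<exists>w\<in>W. v = y @ w \<and> u = x @ w)"
  unfolding rel_def using mem_gen1 by simp

lemma self_rel: "p \<in> rel (Some p)"
  using gen_incl[of "{p}"] by (simp add: rel_def)

lemma PM_Some: "Some (y, x) \<in> PM \<longleftrightarrow> y \<in> W \<and> x \<in> W"
  unfolding PM_def by auto

lemma None_PM [simp]: "None \<in> PM" by (simp add: PM_def)

lemma PM_cases [case_names None Some]:
  assumes "a \<in> PM"
  obtains "a = None" | y x where "a = Some (y, x)" "y \<in> W" "x \<in> W"
  using assms unfolding PM_def by auto

lemma rideal_rel: "a \<in> PM \<Longrightarrow> rideal (rel a)"
  by (erule PM_cases) (auto simp: rel_def rideal_gen rideal_def[of "{}"])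

lemma drop_W: "w \<in> W \<Longrightarrow> drop k w \<in> W"
  by (auto simp: in_lists_conv_set dest: in_set_dropD)

lemma pmult_PM: "a \<in> PM \<Longrightarrow> b \<in> PM \<Longrightarrow> pmult a b \<in> PM"
  by (erule PM_cases; erule PM_cases) (auto simp: PM_Some drop_W)

lemma rel_pmult:
  assumes "a \<in> PM" "b \<in> PM"
  shows "rel (pmult a b) = rel a O rel b"
  using assms(1)
proof (cases a rule: PM_cases)
  case (Some y x)
  note a = this
  show ?thesis using assms(2)
  proof (cases b rule: PM_cases)
    case (Some v u)
    consider z where "v = x @ z" | z where "x = v @ z" "z \<noteq> []" | "\<not> prefix x v" "\<not> prefix v x"
      unfolding prefix_def by fastforce
    then show ?thesis
    proof cases
      case 1
      then have "z \<in> W" using Some by simp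
      have "(p, q) \<in> rel (pmult a b) \<longleftrightarrow> (p, q) \<in> rel a O rel b" for p q
      proof -
        have "(p, q) \<in> rel a O rel b \<longleftrightarrow> (\<exists>w\<in>W. \<exists>w'\<in>W. p = y @ w \<and> q = u @ w' \<and> x @ w = v @ w')"
          unfolding relcomp_unfold using a Some by (auto simp: mem_rel)
        also have "\<dots> \<longleftrightarrow> (\<exists>w'\<in>W. p = y @ z @ w' \<and> q = u @ w')"
          using 1 \<open>z \<in> W\<close> by auto
        finally show ?thesis
          using a Some 1 by (simp add: mem_rel)
      qed
      then show ?thesis by auto
    next
      case 2
      then have "z \<in> W" using a by simp
      have "(p, q) \<in> rel (pmult a b) \<longleftrightarrow> (p, q) \<in> rel a O rel b" for p q
      proof -
        have "(p, q) \<in> rel a O rel b \<longleftrightarrow> (\<exists>w\<in>W. \<exists>w'\<in>W. p = y @ w \<and> q = u @ w' \<and> x @ w = v @ w')"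
          unfolding relcomp_unfold using a Some by (auto simp: mem_rel)
        also have "\<dots> \<longleftrightarrow> (\<exists>w\<in>W. p = y @ w \<and> q = u @ z @ w)"
          using 2 \<open>z \<in> W\<close> by auto
        finally show ?thesis
          using a Some 2 by (simp add: mem_rel)
      qed
      then show ?thesis by auto
    next
      case 3
      have "\<not> (x @ w = v @ w')" for w w'
        using 3 by (metis prefixI prefix_same_cases)
      then have "rel a O rel b = {}" using a Some by (auto simp: mem_rel)
      then show ?thesis using 3 a Some by simp
    qed
  qed simp
qed simp

lemma rel_subset_iff:
  assumes "b \<in> PM"
  shows "rel (Some p) \<subseteq> rel b \<longleftrightarrow> p \<in> rel b"
proof
  assume "p \<in> rel b"
  then show "rel (Some p) \<subseteq> rel b"
    using gen_least[OF rideal_rel[OF assms], of "{p}"] by (simp add: rel_def)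
qed (use self_rel in blast)

text \<open>Each generating pair extends the other one by a common suffix, so both suffixes are
  empty.\<close>

lemma rel_inj:
  assumes "a \<in> PM" "b \<in> PM" "rel a = rel b"
  shows "a = b"
proof (cases a)
  case None
  then show ?thesis using assms self_rel by (cases b) auto
next
  case (Some p)
  then have "p \<in> rel b" using assms self_rel by blast
  then obtain q where q: "b = Some q" by (cases b) auto
  then have "q \<in> rel a" using assms self_rel by blast
  with \<open>p \<in> rel b\<close> show ?thesis using Some q
    by (cases p; cases q) (fastforce simp: mem_rel)
qed

lemma pmult_assoc: "a \<in> PM \<Longrightarrow> b \<in> PM \<Longrightarrow> c \<in> PM \<Longrightarrow> pmult (pmult a b) c = pmult a (pmult b c)"
  by (rule rel_inj) (simp_all add: pmult_PM rel_pmult O_assoc)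

lemma pbij_rel: "pbij (rel a)"
  by (cases a) (auto simp: pbij_iff mem_rel)

section \<open>Idempotents, natural order, inverses and meets\<close>

lemma pmult_idem_iff:
  assumes "a \<in> PM"
  shows "pmult a a = a \<longleftrightarrow> rel a \<subseteq> Id"
  using assms
proof (cases a rule: PM_cases)
  case (Some y x)
  have "rel a \<subseteq> Id \<longleftrightarrow> y = x"
  proof
    assume "rel a \<subseteq> Id"
    then show "y = x" using self_rel[of "(y, x)"] Some by auto
  qed (use Some in \<open>auto simp: mem_rel\<close>)
  moreover have "pmult a a = a \<longleftrightarrow> y = x"
    using Some by (auto simp: prefix_def)
  ultimately show ?thesis by simp
qed simp

lemma le_iff:
  assumes "a \<in> PM" "b \<in> PM"
  shows "(\<exists>e\<in>PM. pmult e e = e \<and> a = pmult b e) \<longleftrightarrow> rel a \<subseteq> rel b"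
proof
  assume "\<exists>e\<in>PM. pmult e e = e \<and> a = pmult b e"
  then obtain e where "e \<in> PM" "rel e \<subseteq> Id" "a = pmult b e" using pmult_idem_iff by blast
  then show "rel a \<subseteq> rel b" using rel_pmult assms by auto
next
  assume sub: "rel a \<subseteq> rel b"
  show "\<exists>e\<in>PM. pmult e e = e \<and> a = pmult b e"
  proof (cases a)
    case None
    then show ?thesis by (intro bexI[of _ None]) auto
  next
    case (Some p)
    have "p \<in> rel b" using sub Some self_rel by blast
    then obtain y x where b: "b = Some (y, x)" by (cases b) auto
    with \<open>p \<in> rel b\<close> obtain w where "w \<in> W" "p = (y @ w, x @ w)"
      by (cases p) (auto simp: mem_rel)
    \<comment> \<open>The idempotent with both components \<open>x @ w\<close> restricts
      \<open>b\<close> to the words that begin with \<open>x @ w\<close>, which leaves exactly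
      \<open>a\<close>.\<close>
    with b show ?thesis using Some assms
      by (intro bexI[of _ "Some (x @ w, x @ w)"]) (auto simp: PM_Some)
  qed
qed

definition pinv :: "pm \<Rightarrow> pm" where "pinv a = map_option prod.swap a"

lemma pinv_PM: "a \<in> PM \<Longrightarrow> pinv a \<in> PM"
  unfolding PM_def pinv_def by auto

lemma rel_pinv: "rel (pinv a) = (rel a)\<inverse>"
  using gen_converse by (cases a) (auto simp: pinv_def rel_def gen_def)

lemma pinv_iff:
  assumes "a \<in> PM" "b \<in> PM"
  shows "pmult (pmult a b) a = a \<and> pmult (pmult b a) b = b \<longleftrightarrow> b = pinv a"
proof
  assume "pmult (pmult a b) a = a \<and> pmult (pmult b a) b = b"
  then have *: "rel a O rel b O rel a = rel a" "rel b O rel a O rel b = rel b"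
    using assms rel_pmult[of "pmult a b" a] rel_pmult[of "pmult b a" b]
    by (auto simp: rel_pmult pmult_PM O_assoc)
  have "rel b = rel (pinv a)" unfolding rel_pinv
    using pbij_subset_converse[OF pbij_rel *(1)] pbij_subset_converse[OF pbij_rel *(2)] by blast
  then show "b = pinv a" using assms pinv_PM rel_inj by blast
next
  assume b: "b = pinv a"
  have "rel a O (rel a)\<inverse> O rel a = rel a" "(rel a)\<inverse> O rel a O (rel a)\<inverse> = (rel a)\<inverse>"
    using pbij_comp_converse[OF pbij_rel[of a]] pbij_comp_converse[of "(rel a)\<inverse>"]
    by (auto simp: pbij_converse pbij_rel)
  then show "pmult (pmult a b) a = a \<and> pmult (pmult b a) b = b"
    using assms b by (auto intro!: rel_inj simp: pmult_PM rel_pmult rel_pinv O_assoc)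
qed

text \<open>Two of these graphs are disjoint or nested. At a common point
  \<open>p = y @ w = v @ w'\<close> the words \<open>w\<close> and \<open>w'\<close> are suffixes of
  \<open>p\<close>, so one is a suffix of the other, and cancelling it shows that one generating
  pair extends the other.\<close>

lemma rel_meet:
  assumes "a \<in> PM" "b \<in> PM"
  shows "\<exists>m\<in>PM. rel m = rel a \<inter> rel b"
proof (cases "rel a \<inter> rel b = {}")
  case True
  then show ?thesis by (intro bexI[of _ None]) auto
next
  case False
  then obtain p q where pq: "(p, q) \<in> rel a" "(p, q) \<in> rel b" by auto
  then obtain y x v u w w' where *: "a = Some (y, x)" "b = Some (v, u)" "w \<in> W" "w' \<in> W"
    "p = y @ w" "q = x @ w" "p = v @ w'" "q = u @ w'"
    using assms by (cases a; cases b) (auto simp: mem_rel)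
  then have "y @ w = v @ w'" "x @ w = u @ w'" by auto
  have "suffix w w' \<or> suffix w' w"
    using \<open>y @ w = v @ w'\<close> by (metis suffixI suffix_same_cases)
  then have "rel a \<subseteq> rel b \<or> rel b \<subseteq> rel a"
  proof
    assume "suffix w w'"
    then obtain c where "w' = c @ w" unfolding suffix_def by blast
    then have "rel b \<subseteq> rel a \<or> rel a \<subseteq> rel b"
      using * by (auto simp: mem_rel)
    then show ?thesis by blast
  next
    assume "suffix w' w"
    then obtain c where "w = c @ w'" unfolding suffix_def by blast
    then have "rel b \<subseteq> rel a \<or> rel a \<subseteq> rel b"
      using * by (auto simp: mem_rel)
    then show ?thesis by blast
  qed
  then show ?thesis using assms by (metis Int_absorb1 Int_absorb2)
qed

text \<open>Closedness of single elements is the reason why \<open>\<leftrightarrow>\<close> is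
  equality on the polycyclic monoid. Only a pair \<open>(v, u)\<close> properly shorter than the
  generator \<open>(y, x)\<close> could be new in the closure.\<close>

lemma cl_rel:
  assumes "a \<in> PM"
  shows "cl (rel a) = rel a"
proof
  show "rel a \<subseteq> cl (rel a)" by (rule cl_incl[OF rideal_rel[OF assms]])
  show "cl (rel a) \<subseteq> rel a"
  proof (clarify)
    fix v u assume vu: "(v, u) \<in> cl (rel a)"
    obtain y x where a: "a = Some (y, x)" using clD0[OF vu] by (cases a) auto
    obtain z t where z: "z \<in> W" "t \<in> W" "v @ z = y @ t" "u @ z = x @ t"
      using clD0[OF vu] a by (auto simp: mem_rel)
    have "suffix z t \<or> suffix t z" using z(3) by (metis suffixI suffix_same_cases)
    then show "(v, u) \<in> rel a"
    proof
      assume "suffix z t"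
      then obtain c where "t = c @ z" unfolding suffix_def by blast
      then show ?thesis using z a by (auto simp: mem_rel)
    next
      assume "suffix t z"
      then obtain c where c: "z = c @ t" unfolding suffix_def by blast
      then have vu': "y = v @ c" "x = u @ c" using z by auto
      have "c = []"
      proof (rule ccontr)
        assume "c \<noteq> []"
        \<comment> \<open>As \<open>n\<close> is at least 2, some letter differs from the first
          letter of \<open>c\<close>. No extension of \<open>v @ [i]\<close> begins with
          \<open>y = v @ c\<close>, so \<open>(v, u)\<close> cannot lie in the closure.\<close>
        define i where "i = (if hd c = 0 then 1 else 0 :: nat)"
        have i: "i \<noteq> hd c" "[i] \<in> W" using n2 by (auto simp: i_def)
        obtain z' where "(v @ [i] @ z', u @ [i] @ z') \<in> rel a" using clD[OF vu i(2)] by blast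
        then obtain t' where "v @ [i] @ z' = y @ t'" using a by (auto simp: mem_rel)
        then have "i # z' = c @ t'" using vu' by simp
        then show False using i(1) \<open>c \<noteq> []\<close> by (cases c) auto
      qed
      then show ?thesis using vu' a self_rel by simp
    qed
  qed
qed

end

section \<open>Quotients by kernels\<close>

definition fibre :: "('a, 'm) monoid_scheme \<Rightarrow> ('a \<Rightarrow> 'b) \<Rightarrow> 'b \<Rightarrow> 'a set" where
  "fibre S k c = {a \<in> carrier S. k a = c}"

definition kernel_rel :: "('a, 'm) monoid_scheme \<Rightarrow> ('a \<Rightarrow> 'b) \<Rightarrow> ('a \<times> 'a) set" where
  "kernel_rel S k = {(a, b). a \<in> carrier S \<and> b \<in> carrier S \<and> k a = k b}"

lemma kernel_rel_congruence:
  assumes "k \<in> hom S M" "\<And>x y. x \<in> carrier S \<Longrightarrow> y \<in> carrier S \<Longrightarrow> x \<otimes>\<^bsub>S\<^esub> y \<in> carrier S"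
  shows "semigroup_congruence S (kernel_rel S k)"
  unfolding semigroup_congruence_def kernel_rel_def
  using assms by (auto simp: equiv_def refl_on_def sym_def trans_def hom_def)

text \<open>The first isomorphism theorem, directed from the image to the quotient so that the map
  is given by fibres instead of chosen representatives. The identity is treated separately because
  \<open>iso\<close> does not constrain the \<open>one\<close> component.\<close>

lemma kernel_quotient_iso:
  assumes k: "k \<in> hom S M" and surj: "k ` carrier S = carrier M"
    and closed: "\<And>x y. x \<in> carrier S \<Longrightarrow> y \<in> carrier S \<Longrightarrow> x \<otimes>\<^bsub>S\<^esub> y \<in> carrier S"
    and one: "\<one>\<^bsub>S\<^esub> \<in> carrier S" "k \<one>\<^bsub>S\<^esub> = \<one>\<^bsub>M\<^esub>"
  shows "fibre S k \<in> iso M (quotient_semigroup S (kernel_rel S k))"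
    and "fibre S k \<one>\<^bsub>M\<^esub> = \<one>\<^bsub>quotient_semigroup S (kernel_rel S k)\<^esub>"
proof -
  have cls: "kernel_rel S k `` {a} = fibre S k (k a)" if "a \<in> carrier S" for a
    using that unfolding kernel_rel_def fibre_def by auto
  have car: "carrier S // kernel_rel S k = fibre S k ` carrier M"
    unfolding quotient_def surj[symmetric] by (auto simp: cls)
  \<comment> \<open>Non-emptiness of fibres enters twice: an element is recovered from its fibre,
    and the product in the quotient is a union indexed by two fibres, which equals a single class
    only if both are inhabited.\<close>
  have ne: "\<exists>a\<in>carrier S. a \<in> fibre S k c \<and> k a = c" if "c \<in> carrier M" for c
  proof -
    have "c \<in> k ` carrier S" using that surj by simp
    then show ?thesis unfolding fibre_def by blast
  qed
  have inj: "inj_on (fibre S k) (carrier M)"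
  proof (rule inj_onI)
    fix c d assume "c \<in> carrier M" "d \<in> carrier M" and eq: "fibre S k c = fibre S k d"
    then obtain a where "a \<in> fibre S k c" using ne by blast
    then show "c = d" using eq unfolding fibre_def by auto
  qed
  have mult: "(\<Union>x\<in>fibre S k c. \<Union>y\<in>fibre S k d. kernel_rel S k `` {x \<otimes>\<^bsub>S\<^esub> y}) = fibre S k (c \<otimes>\<^bsub>M\<^esub> d)"
    if "c \<in> carrier M" "d \<in> carrier M" for c d
  proof -
    have "kernel_rel S k `` {x \<otimes>\<^bsub>S\<^esub> y} = fibre S k (c \<otimes>\<^bsub>M\<^esub> d)" if "x \<in> fibre S k c" "y \<in> fibre S k d" for x y
    proof -
      have "k (x \<otimes>\<^bsub>S\<^esub> y) = c \<otimes>\<^bsub>M\<^esub> d" using that k unfolding fibre_def hom_def by auto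
      then show ?thesis using that cls closed unfolding fibre_def by auto
    qed
    then show ?thesis using ne[OF that(1)] ne[OF that(2)] by fast
  qed
  show "fibre S k \<in> iso M (quotient_semigroup S (kernel_rel S k))"
    unfolding iso_def hom_def bij_betw_def quotient_semigroup_def
    using car inj mult by auto
  show "fibre S k \<one>\<^bsub>M\<^esub> = \<one>\<^bsub>quotient_semigroup S (kernel_rel S k)\<^esub>"
    using one cls unfolding quotient_semigroup_def by simp
qed

section \<open>Normal forms in the polycyclic monoid\<close>

fun letter_pm :: "letter \<Rightarrow> pm" where
  "letter_pm (Gen i) = Some ([i], [])"
| "letter_pm (GenInv i) = Some ([], [i])"

fun word_pm :: "letter list \<Rightarrow> pm" where
  "word_pm [] = Some ([], [])"
| "word_pm (l # u) = pmult (letter_pm l) (word_pm u)"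

fun pm_of :: "letter list option \<Rightarrow> pm" where
  "pm_of None = None"
| "pm_of (Some u) = word_pm u"

text \<open>Inverting a product reverses its factors, hence \<open>rev\<close>.\<close>

fun nf :: "pm \<Rightarrow> letter list option" where
  "nf None = None"
| "nf (Some (y, x)) = Some (map Gen y @ rev (map GenInv x))"

lemma pmult_one [simp]: "pmult (Some ([], [])) a = a" "pmult a (Some ([], [])) = a"
  by (cases a; auto simp: prefix_def)+

context polycyclic
begin

definition pm_monoid :: "pm monoid" where
  "pm_monoid = \<lparr>carrier = PM, mult = pmult, one = Some ([], [])\<rparr>"

lemma pm_monoid_simps [simp]:
  "carrier pm_monoid = PM" "mult pm_monoid = pmult" "one pm_monoid = Some ([], [])"
  by (simp_all add: pm_monoid_def)

abbreviation L :: "letter list set" where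
  "L \<equiv> lists (Gen ` {..<n} \<union> GenInv ` {..<n})"

abbreviation FM :: "letter list option monoid" where "FM \<equiv> free_monoid_zero n"

lemma carrier_FM: "carrier FM = insert None (Some ` L)"
  by (simp add: free_monoid_zero_def)

lemma one_FM: "\<one>\<^bsub>FM\<^esub> = Some []"
  by (simp add: free_monoid_zero_def)

lemma mult_FM [simp]:
  "Some u \<otimes>\<^bsub>FM\<^esub> Some v = Some (u @ v)" "None \<otimes>\<^bsub>FM\<^esub> a = None" "a \<otimes>\<^bsub>FM\<^esub> None = None"
  by (simp_all add: free_monoid_zero_def split: option.split)

lemma closed_FM: "a \<in> carrier FM \<Longrightarrow> b \<in> carrier FM \<Longrightarrow> a \<otimes>\<^bsub>FM\<^esub> b \<in> carrier FM"
  by (auto simp: carrier_FM)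

lemma one_PM [simp]: "Some ([], []) \<in> PM" by (simp add: PM_Some)

lemma letter_PM: "l \<in> Gen ` {..<n} \<union> GenInv ` {..<n} \<Longrightarrow> letter_pm l \<in> PM"
  by (auto simp: PM_Some)

lemma word_PM: "u \<in> L \<Longrightarrow> word_pm u \<in> PM"
  by (induction u) (simp_all add: letter_PM pmult_PM)

lemma word_pm_append: "u \<in> L \<Longrightarrow> v \<in> L \<Longrightarrow> word_pm (u @ v) = pmult (word_pm u) (word_pm v)"
  by (induction u) (simp_all add: letter_PM word_PM pmult_assoc)

lemma pm_of_hom: "pm_of \<in> hom FM pm_monoid"
  unfolding hom_def by (auto simp: carrier_FM word_PM word_pm_append)

lemma nf_FM: "a \<in> PM \<Longrightarrow> nf a \<in> carrier FM"
  by (erule PM_cases) (auto simp: carrier_FM in_lists_conv_set)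

lemma word_pm_Gen: "word_pm (map Gen y @ u) = pmult (Some (y, [])) (word_pm u)"
proof (induction y)
  case (Cons i y)
  then show ?case by (cases "word_pm u") (auto simp: prefix_def)
qed simp

lemma word_pm_GenInv: "word_pm (rev (map GenInv x)) = Some ([], x)"
proof (induction x rule: rev_induct)
  case (snoc i x)
  then show ?case by (auto simp: prefix_def)
qed simp

lemma pm_of_nf: "pm_of (nf a) = a"
  by (cases a rule: nf.cases) (simp_all add: word_pm_Gen word_pm_GenInv)

text \<open>By induction, a letter is multiplied onto a normal form from the left. The result is
  again in normal form unless \<open>GenInv i\<close> meets a leading \<open>Gen j\<close>; then one
  defining relation, multiplied on the right by the remaining word, cancels the two letters or gives
  zero.\<close>

lemma nf_congruent:
  assumes r: "semigroup_congruence FM r" "polycyclic_relations n \<subseteq> r" and "u \<in> L"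
  shows "(Some u, nf (word_pm u)) \<in> r"
  using \<open>u \<in> L\<close>
proof (induction u rule: list.induct)
  have refl: "a \<in> carrier FM \<Longrightarrow> (a, a) \<in> r" for a
    using r(1) unfolding semigroup_congruence_def equiv_def refl_on_def by blast
  have trans: "(a, b) \<in> r \<Longrightarrow> (b, c) \<in> r \<Longrightarrow> (a, c) \<in> r" for a b c
    using r(1) unfolding semigroup_congruence_def equiv_def trans_def by blast
  have cong: "(a, b) \<in> r \<Longrightarrow> (c, d) \<in> r \<Longrightarrow> (a \<otimes>\<^bsub>FM\<^esub> c, b \<otimes>\<^bsub>FM\<^esub> d) \<in> r" for a b c d
    using r(1) unfolding semigroup_congruence_def by blast
  {
    case Nil
    show ?case using refl by (simp add: carrier_FM)
  next
    case (Cons l u)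
    let ?a = "word_pm u"
    have u: "u \<in> L" "?a \<in> PM" using Cons.prems word_PM by auto
    have l: "l \<in> Gen ` {..<n} \<union> GenInv ` {..<n}" using Cons.prems by simp
    have lr: "(Some [l], Some [l]) \<in> r" using refl l by (simp add: carrier_FM)
    have "(Some (l # u), Some [l] \<otimes>\<^bsub>FM\<^esub> nf ?a) \<in> r"
      using cong[OF lr Cons.IH[OF u(1)]] by simp
    moreover have "(Some [l] \<otimes>\<^bsub>FM\<^esub> nf ?a, nf (pmult (letter_pm l) ?a)) \<in> r"
      using u(2)
    proof (cases "?a" rule: PM_cases)
      case None
      then show ?thesis using refl by (simp add: carrier_FM)
    next
      case (Some y x)
      have fm: "Some [l] \<otimes>\<^bsub>FM\<^esub> nf ?a \<in> carrier FM"
        using l nf_FM[OF u(2)] by (intro closed_FM) (auto simp: carrier_FM)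
      have tail: "(Some (map Gen v @ rev (map GenInv x)), Some (map Gen v @ rev (map GenInv x))) \<in> r"
        if "v \<in> W" for v
        using refl[OF nf_FM[of "Some (v, x)"]] that Some(3) by (simp add: PM_Some)
      show ?thesis
      proof (cases l)
        case (Gen i)
        then have "nf (pmult (letter_pm l) ?a) = Some [l] \<otimes>\<^bsub>FM\<^esub> nf ?a" using Some by simp
        then show ?thesis using refl[OF fm] by simp
      next
        case (GenInv i)
        show ?thesis
        proof (cases y)
          case Nil
          then have "nf (pmult (letter_pm l) ?a) = Some [l] \<otimes>\<^bsub>FM\<^esub> nf ?a" using Some GenInv by simp
          then show ?thesis using refl[OF fm] by simp
        next
          case (Cons j v)
          have ij: "i < n" "j < n" "v \<in> W" using l GenInv Some(2) Cons by auto
          show ?thesis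
          proof (cases "i = j")
            case True
            have "(Some [GenInv i, Gen i], Some []) \<in> r"
              using r(2) ij unfolding polycyclic_relations_def by blast
            from cong[OF this tail[OF ij(3)]] show ?thesis
              using True Cons Some GenInv by simp
          next
            case False
            have "(Some [GenInv i, Gen j], None) \<in> r"
              using r(2) ij False unfolding polycyclic_relations_def by blast
            from cong[OF this tail[OF ij(3)]] show ?thesis
              using False Cons Some GenInv by simp
          qed
        qed
      qed
    qed
    ultimately show ?case using trans by simp
  }
qed

text \<open>The kernel is a congruence that contains the relations. Conversely, in every such
  congruence each word is related to its normal form, which depends only on its value under
  \<open>pm_of\<close>.\<close>

lemma generated_congruence_eq: "generated_congruence FM (polycyclic_relations n) = kernel_rel FM pm_of"
proof
  have "polycyclic_relations n \<subseteq> kernel_rel FM pm_of"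
    unfolding polycyclic_relations_def kernel_rel_def by (auto simp: carrier_FM)
  then show "generated_congruence FM (polycyclic_relations n) \<subseteq> kernel_rel FM pm_of"
    using kernel_rel_congruence[OF pm_of_hom closed_FM] unfolding generated_congruence_def by blast
  show "kernel_rel FM pm_of \<subseteq> generated_congruence FM (polycyclic_relations n)"
    unfolding generated_congruence_def
  proof (intro Inter_greatest subrelI, elim CollectE conjE)
    fix r a b
    assume r: "semigroup_congruence FM r" "polycyclic_relations n \<subseteq> r"
      and ab: "(a, b) \<in> kernel_rel FM pm_of"
    have eq: "equiv (carrier FM) r" using r(1) unfolding semigroup_congruence_def by blast
    have nf: "(c, nf (pm_of c)) \<in> r" if "c \<in> carrier FM" for c
    proof (cases c)
      case None
      then show ?thesis using eq that by (auto simp: equiv_def refl_on_def)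
    next
      case (Some u)
      then show ?thesis using nf_congruent[OF r] that by (auto simp: carrier_FM)
    qed
    have "(a, nf (pm_of a)) \<in> r" "(b, nf (pm_of a)) \<in> r"
      using nf[of a] nf[of b] ab unfolding kernel_rel_def by auto
    then show "(a, b) \<in> r" using eq by (meson equiv_def symD transD)
  qed
qed

lemma polycyclic_monoid_iso:
  "fibre FM pm_of \<in> iso pm_monoid (polycyclic_monoid n)"
  "fibre FM pm_of \<one>\<^bsub>pm_monoid\<^esub> = \<one>\<^bsub>polycyclic_monoid n\<^esub>"
proof -
  have "pm_of ` carrier FM = carrier pm_monoid"
  proof
    show "carrier pm_monoid \<subseteq> pm_of ` carrier FM"
      using pm_of_nf nf_FM by (metis image_eqI pm_monoid_simps(1) subsetI)
  qed (use pm_of_hom in \<open>auto simp: hom_def\<close>)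
  from kernel_quotient_iso[OF pm_of_hom this closed_FM]
  show "fibre FM pm_of \<in> iso pm_monoid (polycyclic_monoid n)"
    "fibre FM pm_of \<one>\<^bsub>pm_monoid\<^esub> = \<one>\<^bsub>polycyclic_monoid n\<^esub>"
    unfolding polycyclic_monoid_def generated_congruence_eq
    by (auto simp: carrier_FM one_FM)
qed

end

text \<open>In this form the condition distributes over unions: a union of relations satisfies it
  iff all pairs of them do. That is how pairwise compatibility of a set becomes \<open>pbij\<close>
  of its union in \<open>compatible_generators_S\<close>.\<close>

lemma pbij_iff_Id: "pbij R \<longleftrightarrow> R\<inverse> O R \<subseteq> Id \<and> R O R\<inverse> \<subseteq> Id"
proof -
  have "R\<inverse> O R \<subseteq> Id \<longleftrightarrow> (\<forall>y x x'. (y, x) \<in> R \<longrightarrow> (y, x') \<in> R \<longrightarrow> x = x')" by blast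
  moreover have "R O R\<inverse> \<subseteq> Id \<longleftrightarrow> (\<forall>y y' x. (y, x) \<in> R \<longrightarrow> (y', x) \<in> R \<longrightarrow> y = y')" by blast
  ultimately show ?thesis by (simp add: pbij_iff)
qed

context polycyclic
begin

section \<open>A model of the Cuntz inverse monoid\<close>

definition model :: "(nat list \<times> nat list) set monoid" where
  "model = \<lparr>carrier = {cl (gen F) | F. finite F \<and> F \<subseteq> W \<times> W \<and> pbij (gen F)},
            mult = (\<lambda>R S. cl (R O S)), one = Id_on W\<rparr>"

lemma model_simps [simp]: "R \<otimes>\<^bsub>model\<^esub> S = cl (R O S)" "\<one>\<^bsub>model\<^esub> = Id_on W"
  by (simp_all add: model_def)

lemma modelI: "finite F \<Longrightarrow> F \<subseteq> W \<times> W \<Longrightarrow> pbij (gen F) \<Longrightarrow> cl (gen F) \<in> carrier model"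
  unfolding model_def by auto

lemma modelE:
  assumes "R \<in> carrier model"
  obtains F where "finite F" "F \<subseteq> W \<times> W" "pbij (gen F)" "R = cl (gen F)"
  using assms unfolding model_def by auto

lemma model_rideal: "R \<in> carrier model \<Longrightarrow> rideal R"
  by (auto elim!: modelE intro: rideal_cl)

lemma model_pbij: "R \<in> carrier model \<Longrightarrow> pbij R"
  by (auto elim!: modelE intro: pbij_cl rideal_gen)

lemma model_cl: "R \<in> carrier model \<Longrightarrow> cl R = R"
  by (auto elim!: modelE simp: cl_idem)

text \<open>Composition distributes over the unions of principal relations, and a composite of two
  principal relations is principal or empty. Hence composites of finitely generated relations are
  finitely generated.\<close>

lemma gen_comp:
  assumes "F \<subseteq> W \<times> W" "G \<subseteq> W \<times> W"
  shows "gen F O gen G = gen {p. \<exists>f\<in>F. \<exists>g\<in>G. pmult (Some f) (Some g) = Some p}"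
proof -
  have rp: "rel (pmult (Some f) (Some g)) = rel (Some f) O rel (Some g)" if "f \<in> F" "g \<in> G" for f g
    using that assms by (intro rel_pmult) (auto simp: PM_def)
  have "gen F O gen G = (\<Union>f\<in>F. \<Union>g\<in>G. rel (Some f) O rel (Some g))"
    using gen_UN[of F] gen_UN[of G] by (auto simp: rel_def)
  also have "\<dots> = (\<Union>f\<in>F. \<Union>g\<in>G. rel (pmult (Some f) (Some g)))" using rp by simp
  also have "\<dots> = (\<Union>f\<in>F. \<Union>g\<in>G. \<Union>p\<in>{p. pmult (Some f) (Some g) = Some p}. gen {p})"
    by (intro SUP_cong refl) (simp add: rel_def split: option.split)
  also have "\<dots> = gen {p. \<exists>f\<in>F. \<exists>g\<in>G. pmult (Some f) (Some g) = Some p}"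
    unfolding gen_UN[of "Collect _"] by blast
  finally show ?thesis .
qed

lemma model_closed:
  assumes "R \<in> carrier model" "S \<in> carrier model"
  shows "R \<otimes>\<^bsub>model\<^esub> S \<in> carrier model"
proof -
  obtain F G where F: "finite F" "F \<subseteq> W \<times> W" "pbij (gen F)" "R = cl (gen F)"
    and G: "finite G" "G \<subseteq> W \<times> W" "pbij (gen G)" "S = cl (gen G)"
    using assms by (auto elim!: modelE)
  let ?H = "{p. \<exists>f\<in>F. \<exists>g\<in>G. pmult (Some f) (Some g) = Some p}"
  have "?H \<subseteq> (\<lambda>(f, g). the (pmult (Some f) (Some g))) ` (F \<times> G)"
    by (force intro!: image_eqI)
  then have "finite ?H" using F(1) G(1) by (meson finite_SigmaI finite_imageI finite_subset)
  moreover have "?H \<subseteq> W \<times> W"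
  proof clarify
    fix y x f1 f2 g1 g2 assume *: "(f1, f2) \<in> F" "(g1, g2) \<in> G" "pmult (Some (f1, f2)) (Some (g1, g2)) = Some (y, x)"
    then have "Some (y, x) \<in> PM" using F(2) G(2) pmult_PM[of "Some (f1, f2)" "Some (g1, g2)"]
      by (auto simp: PM_Some)
    then show "y \<in> W \<and> x \<in> W" by (simp add: PM_Some)
  qed
  moreover have "pbij (gen ?H)"
    unfolding gen_comp[OF F(2) G(2), symmetric] using F(3) G(3) by (rule pbij_comp)
  ultimately have "cl (gen ?H) \<in> carrier model" by (rule modelI)
  then show ?thesis
    using gen_comp[OF F(2) G(2)] F(4) G(4) cl_comp[OF rideal_gen rideal_gen] F(2) G(2) by simp
qed

lemma gen_one: "gen {([], [])} = Id_on W"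
  unfolding gen_def by auto

lemma cl_one: "cl (Id_on W) = Id_on W"
  unfolding cl_def by (auto intro: exI[of _ "[]"])

lemma model_one: "\<one>\<^bsub>model\<^esub> \<in> carrier model"
proof -
  have "pbij (Id_on W)" by (auto simp: pbij_iff)
  then show ?thesis using modelI[of "{([], [])}"] by (simp add: gen_one cl_one)
qed

lemma W_comp: "rideal R \<Longrightarrow> Id_on W O R = R" "rideal R \<Longrightarrow> R O Id_on W = R"
  by (auto dest: rideal_W)

lemma monoid_model: "monoid model"
proof (rule monoidI)
  fix R S T assume a: "R \<in> carrier model" "S \<in> carrier model" "T \<in> carrier model"
  then have r: "rideal R" "rideal S" "rideal T" and c: "cl R = R" "cl S = S" "cl T = T"
    using model_rideal model_cl by auto
  have "cl (cl (R O S) O T) = cl ((R O S) O T)"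
    using cl_comp[of "R O S" T] r c by (simp add: rideal_comp)
  moreover have "cl (R O cl (S O T)) = cl (R O S O T)"
    using cl_comp[of R "S O T"] r c by (simp add: rideal_comp)
  ultimately show "R \<otimes>\<^bsub>model\<^esub> S \<otimes>\<^bsub>model\<^esub> T = R \<otimes>\<^bsub>model\<^esub> (S \<otimes>\<^bsub>model\<^esub> T)" by (simp add: O_assoc)
qed (auto simp: model_rideal W_comp model_cl model_closed[simplified] model_one[simplified])

end

section \<open>The distributive completion of a copy of the polycyclic monoid\<close>

text \<open>Working with an arbitrary copy allows two applications: to
  \<open>polycyclic_monoid n\<close>, and to its quotient by \<open>biarrow_rel\<close>, over which
  the ideals of the completion are formed. By \<open>quotient_copy\<close> the second is again a
  copy.\<close>

locale polycyclic_copy = polycyclic +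
  fixes S :: "'a monoid" and \<theta> :: "pm \<Rightarrow> 'a"
  assumes iso: "\<theta> \<in> iso pm_monoid S" and one: "\<theta> (Some ([], [])) = \<one>\<^bsub>S\<^esub>"
begin

lemma carrier_S: "carrier S = \<theta> ` PM"
  using iso by (auto simp: iso_def bij_betw_def)

lemma carrier_S_E:
  assumes "x \<in> A" "A \<subseteq> carrier S"
  obtains a where "a \<in> PM" "x = \<theta> a"
  using assms carrier_S by blast

lemma theta_PM: "a \<in> PM \<Longrightarrow> \<theta> a \<in> carrier S"
  by (simp add: carrier_S)

lemma theta_eq: "a \<in> PM \<Longrightarrow> b \<in> PM \<Longrightarrow> \<theta> a = \<theta> b \<longleftrightarrow> a = b"
  using iso by (auto simp: iso_def bij_betw_def dest: inj_onD)

lemma theta_mult: "a \<in> PM \<Longrightarrow> b \<in> PM \<Longrightarrow> \<theta> a \<otimes>\<^bsub>S\<^esub> \<theta> b = \<theta> (pmult a b)"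
  using iso by (auto simp: iso_def hom_def)

lemma zero_S: "sg_zero S = \<theta> None"
  unfolding sg_zero_def
proof (rule the_equality)
  show "\<theta> None \<in> carrier S \<and> (\<forall>x\<in>carrier S. \<theta> None \<otimes>\<^bsub>S\<^esub> x = \<theta> None \<and> x \<otimes>\<^bsub>S\<^esub> \<theta> None = \<theta> None)"
    by (auto simp: carrier_S theta_mult)
  fix z assume "z \<in> carrier S \<and> (\<forall>x\<in>carrier S. z \<otimes>\<^bsub>S\<^esub> x = z \<and> x \<otimes>\<^bsub>S\<^esub> z = z)"
  then obtain c where c: "c \<in> PM" "z = \<theta> c" "\<theta> c \<otimes>\<^bsub>S\<^esub> \<theta> None = \<theta> c"
    using theta_PM[OF None_PM] by (auto simp: carrier_S)
  then show "z = \<theta> None" using theta_mult[OF c(1) None_PM] by simp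
qed

lemma idempotents_S: "a \<in> PM \<Longrightarrow> \<theta> a \<in> idempotents S \<longleftrightarrow> rel a \<subseteq> Id"
  unfolding idempotents_def by (simp add: theta_PM theta_mult theta_eq pmult_PM pmult_idem_iff)

lemma inverse_S:
  assumes "a \<in> PM"
  shows "sg_inverse S (\<theta> a) = \<theta> (pinv a)"
proof -
  have *: "\<theta> b \<in> carrier S \<and> \<theta> a \<otimes>\<^bsub>S\<^esub> \<theta> b \<otimes>\<^bsub>S\<^esub> \<theta> a = \<theta> a \<and> \<theta> b \<otimes>\<^bsub>S\<^esub> \<theta> a \<otimes>\<^bsub>S\<^esub> \<theta> b = \<theta> b \<longleftrightarrow> b = pinv a"
    if "b \<in> PM" for b
    using pinv_iff[OF assms that] that assms by (simp add: theta_PM theta_mult theta_eq pmult_PM)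
  show ?thesis
    unfolding sg_inverse_def
  proof (rule the_equality)
    fix y assume y: "y \<in> carrier S \<and> \<theta> a \<otimes>\<^bsub>S\<^esub> y \<otimes>\<^bsub>S\<^esub> \<theta> a = \<theta> a \<and> y \<otimes>\<^bsub>S\<^esub> \<theta> a \<otimes>\<^bsub>S\<^esub> y = y"
    then obtain b where "b \<in> PM" "y = \<theta> b" by (auto simp: carrier_S)
    then show "y = \<theta> (pinv a)" using *[of b] y by simp
  qed (use *[OF pinv_PM[OF assms]] in simp)
qed

lemma natural_le_S:
  assumes "a \<in> PM" "b \<in> PM"
  shows "natural_le S (\<theta> a) (\<theta> b) \<longleftrightarrow> rel a \<subseteq> rel b"
proof -
  have "(\<exists>e\<in>idempotents S. \<theta> a = \<theta> b \<otimes>\<^bsub>S\<^esub> e) \<longleftrightarrow> (\<exists>e\<in>PM. \<theta> e \<in> idempotents S \<and> \<theta> a = \<theta> b \<otimes>\<^bsub>S\<^esub> \<theta> e)"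
    by (auto simp: carrier_S idempotents_def)
  also have "\<dots> \<longleftrightarrow> (\<exists>e\<in>PM. pmult e e = e \<and> a = pmult b e)"
    using assms by (auto simp: idempotents_S theta_mult theta_eq pmult_PM pmult_idem_iff)
  finally show ?thesis
    using le_iff[OF assms] assms by (simp add: natural_le_def theta_PM)
qed

lemma natural_leE:
  assumes "natural_le S x (\<theta> b)" "b \<in> PM"
  obtains a where "a \<in> PM" "x = \<theta> a" "rel a \<subseteq> rel b"
proof -
  have "x \<in> carrier S" using assms unfolding natural_le_def by blast
  then obtain a where "a \<in> PM" "x = \<theta> a" by (auto simp: carrier_S)
  with assms natural_le_S that show ?thesis by auto
qed

lemma meet_S:
  assumes "a \<in> PM" "b \<in> PM" "m \<in> PM" "rel m = rel a \<inter> rel b"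
  shows "natural_meet S (\<theta> a) (\<theta> b) = \<theta> m"
  unfolding natural_meet_def
proof (rule the_equality)
  have glb: "natural_le S x (\<theta> m)" if "natural_le S x (\<theta> a)" "natural_le S x (\<theta> b)" for x
    using that(1) assms(1)
  proof (rule natural_leE)
    fix c assume "c \<in> PM" "x = \<theta> c" "rel c \<subseteq> rel a"
    then show ?thesis using that assms by (simp add: natural_le_S)
  qed
  show lb: "natural_le S (\<theta> m) (\<theta> a) \<and> natural_le S (\<theta> m) (\<theta> b) \<and>
      (\<forall>x. natural_le S x (\<theta> a) \<and> natural_le S x (\<theta> b) \<longrightarrow> natural_le S x (\<theta> m))"
    using glb assms by (simp add: natural_le_S)
  fix m' assume m': "natural_le S m' (\<theta> a) \<and> natural_le S m' (\<theta> b) \<and>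
      (\<forall>x. natural_le S x (\<theta> a) \<and> natural_le S x (\<theta> b) \<longrightarrow> natural_le S x m')"
  then have "natural_le S m' (\<theta> m)" "natural_le S (\<theta> m) m'" using lb by blast+
  then show "m' = \<theta> m"
    using assms by (metis natural_leE natural_le_S rel_inj subset_antisym)
qed

lemma meet_nonzero:
  assumes "a \<in> PM" "b \<in> PM"
  shows "natural_meet S (\<theta> a) (\<theta> b) \<noteq> sg_zero S \<longleftrightarrow> rel a \<inter> rel b \<noteq> {}"
proof -
  obtain m where m: "m \<in> PM" "rel m = rel a \<inter> rel b" using rel_meet[OF assms] by blast
  have "m = None \<longleftrightarrow> rel m = {}" using self_rel by (cases m) auto
  then show ?thesis using meet_S[OF assms m] m by (simp add: zero_S theta_eq)
qed

section \<open>The arrow relation as inclusion of closures\<close>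

definition Rel :: "'a set \<Rightarrow> (nat list \<times> nat list) set" where
  "Rel A = (\<Union>a\<in>{a\<in>PM. \<theta> a \<in> A}. rel a)"

lemma rel_subset_Rel: "a \<in> PM \<Longrightarrow> \<theta> a \<in> A \<Longrightarrow> rel a \<subseteq> Rel A"
  unfolding Rel_def by blast

lemma rideal_Rel: "rideal (Rel A)"
proof -
  have "rideal (rel a)" if "a \<in> PM" for a using rideal_rel[OF that] .
  then show ?thesis unfolding rideal_def Rel_def by blast
qed

lemma Rel_single: "a \<in> PM \<Longrightarrow> Rel {\<theta> a} = rel a"
  unfolding Rel_def by (auto simp: theta_eq)

text \<open>The non-zero elements below members of \<open>A\<close> are the
  \<open>\<theta> (Some p)\<close> with \<open>p \<in> Rel A\<close>, and a meet is non-zero iff the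
  graphs intersect. So the arrow says that every pair in \<open>Rel A\<close> has an extension in
  \<open>Rel B\<close>, which is the criterion \<open>subset_cl_iff\<close>.\<close>

lemma arrow_S:
  assumes "A \<subseteq> carrier S" "B \<subseteq> carrier S"
  shows "arrow S A B \<longleftrightarrow> cl (Rel A) \<subseteq> cl (Rel B)"
proof -
  have "arrow S A B \<longleftrightarrow> (\<forall>a\<in>PM. \<theta> a \<in> A \<longrightarrow> (\<forall>c\<in>PM. rel c \<subseteq> rel a \<and> c \<noteq> None \<longrightarrow>
      (\<exists>b\<in>PM. \<theta> b \<in> B \<and> rel c \<inter> rel b \<noteq> {})))" (is "_ \<longleftrightarrow> ?P")
  proof
    assume ar: "arrow S A B"
    show ?P
    proof (intro ballI impI)
      fix a c assume a: "a \<in> PM" "\<theta> a \<in> A" "c \<in> PM" and c: "rel c \<subseteq> rel a \<and> c \<noteq> None"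
      then have "natural_le S (\<theta> c) (\<theta> a)" "\<theta> c \<noteq> sg_zero S"
        by (simp_all add: natural_le_S zero_S theta_eq)
      then obtain b where "b \<in> B" "natural_meet S (\<theta> c) b \<noteq> sg_zero S"
        using ar a unfolding arrow_def by blast
      moreover obtain d where "d \<in> PM" "b = \<theta> d" using \<open>b \<in> B\<close> assms by (auto simp: carrier_S)
      ultimately show "\<exists>b\<in>PM. \<theta> b \<in> B \<and> rel c \<inter> rel b \<noteq> {}"
        using meet_nonzero a by blast
    qed
  next
    assume P: ?P
    show "arrow S A B"
      unfolding arrow_def
    proof (intro ballI allI impI)
      fix x y assume "x \<in> A" and y: "natural_le S y x \<and> y \<noteq> sg_zero S"
      obtain a where a: "a \<in> PM" "x = \<theta> a" using \<open>x \<in> A\<close> assms by (auto simp: carrier_S)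
      obtain c where c: "c \<in> PM" "y = \<theta> c" "rel c \<subseteq> rel a"
        using y a by (auto elim: natural_leE)
      have "c \<noteq> None" using y c(2) zero_S by metis
      then obtain b where "b \<in> PM" "\<theta> b \<in> B" "rel c \<inter> rel b \<noteq> {}"
        using P a c \<open>x \<in> A\<close> by blast
      then show "\<exists>b\<in>B. natural_meet S y b \<noteq> sg_zero S"
        using meet_nonzero c by blast
    qed
  qed
  also have "\<dots> \<longleftrightarrow> (\<forall>p\<in>Rel A. rel (Some p) \<inter> Rel B \<noteq> {})"
  proof
    assume P: ?P
    show "\<forall>p\<in>Rel A. rel (Some p) \<inter> Rel B \<noteq> {}"
    proof
      fix p assume "p \<in> Rel A"
      then obtain a where a: "a \<in> PM" "\<theta> a \<in> A" "p \<in> rel a" unfolding Rel_def by blast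
      have "Some p \<in> PM" using rideal_W[OF rideal_rel[OF a(1)]] a(3) by (cases p) (auto simp: PM_Some)
      then have "\<exists>b\<in>PM. \<theta> b \<in> B \<and> rel (Some p) \<inter> rel b \<noteq> {}"
        using P a rel_subset_iff[OF a(1)] by blast
      then show "rel (Some p) \<inter> Rel B \<noteq> {}" unfolding Rel_def by blast
    qed
  next
    assume Q: "\<forall>p\<in>Rel A. rel (Some p) \<inter> Rel B \<noteq> {}"
    show ?P
    proof (intro ballI impI, elim conjE)
      fix a c assume a: "a \<in> PM" "\<theta> a \<in> A" "c \<in> PM" "rel c \<subseteq> rel a" "c \<noteq> None"
      then obtain p where p: "c = Some p" by blast
      then have "p \<in> Rel A" using a self_rel unfolding Rel_def by blast
      then have "rel c \<inter> Rel B \<noteq> {}" using Q p by blast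
      then show "\<exists>b\<in>PM. \<theta> b \<in> B \<and> rel c \<inter> rel b \<noteq> {}" unfolding Rel_def by blast
    qed
  qed
  also have "\<dots> \<longleftrightarrow> (\<forall>(y, x)\<in>Rel A. \<exists>z\<in>W. (y @ z, x @ z) \<in> Rel B)"
  proof -
    have "rel (Some (y, x)) = (\<lambda>z. (y @ z, x @ z)) ` W" for y x
      by (auto simp: mem_rel)
    then have "rel (Some (y, x)) \<inter> Rel B \<noteq> {} \<longleftrightarrow> (\<exists>z\<in>W. (y @ z, x @ z) \<in> Rel B)" for y x
      by auto
    then show ?thesis by (simp add: split_def) (metis prod.collapse)
  qed
  also have "\<dots> \<longleftrightarrow> cl (Rel A) \<subseteq> cl (Rel B)"
    using subset_cl_iff cl_subset_iff rideal_Rel by simp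
  finally show ?thesis .
qed

lemma biarrow_S:
  "A \<subseteq> carrier S \<Longrightarrow> B \<subseteq> carrier S \<Longrightarrow> biarrow S A B \<longleftrightarrow> cl (Rel A) = cl (Rel B)"
  by (auto simp: biarrow_def arrow_S)

text \<open>Graphs of single elements are closed by \<open>cl_rel\<close> and distinct by
  \<open>rel_inj\<close>, so the relation is equality. Writing equality as the kernel of
  \<open>id\<close> lets \<open>kernel_quotient_iso\<close> treat the quotient.\<close>

lemma biarrow_rel_S: "biarrow_rel S = kernel_rel S id"
proof -
  have "biarrow S {a} {b} \<longleftrightarrow> a = b" if ab: "a \<in> carrier S" "b \<in> carrier S" for a b
  proof -
    obtain c d where "c \<in> PM" "d \<in> PM" "a = \<theta> c" "b = \<theta> d" using ab by (auto simp: carrier_S)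
    moreover from this have "biarrow S {\<theta> c} {\<theta> d} \<longleftrightarrow> rel c = rel d"
      by (simp add: biarrow_S theta_PM Rel_single cl_rel)
    ultimately show ?thesis using rel_inj[of c d] theta_eq by auto
  qed
  then show ?thesis unfolding biarrow_rel_def kernel_rel_def by auto
qed

lemma mult_closed: "x \<in> carrier S \<Longrightarrow> y \<in> carrier S \<Longrightarrow> x \<otimes>\<^bsub>S\<^esub> y \<in> carrier S"
  by (auto simp: carrier_S theta_mult pmult_PM)

lemma quotient_copy:
  "polycyclic_copy n (quotient_semigroup S (biarrow_rel S)) (fibre S id \<circ> \<theta>)"
proof
  have id: "id \<in> hom S S" by (auto simp: hom_def mult_closed)
  have 1: "\<one>\<^bsub>S\<^esub> \<in> carrier S" using one theta_PM[OF one_PM] by simp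
  note q = kernel_quotient_iso[OF id _ mult_closed 1]
  show "fibre S id \<circ> \<theta> \<in> iso pm_monoid (quotient_semigroup S (biarrow_rel S))"
    unfolding biarrow_rel_S using q(1) by (intro iso_set_trans[OF iso]) auto
  show "(fibre S id \<circ> \<theta>) (Some ([], [])) = \<one>\<^bsub>quotient_semigroup S (biarrow_rel S)\<^esub>"
    unfolding biarrow_rel_S using q(2) one by simp
qed

section \<open>Compatible sets, order ideals and the finitary completion\<close>

lemma compatible_S:
  assumes "a \<in> PM" "b \<in> PM"
  shows "sg_compatible S (\<theta> a) (\<theta> b) \<longleftrightarrow> (rel a)\<inverse> O rel b \<subseteq> Id \<and> rel a O (rel b)\<inverse> \<subseteq> Id"
  using assms
  by (simp add: sg_compatible_def inverse_S theta_mult pinv_PM idempotents_S pmult_PM rel_pmult rel_pinv)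

lemma compatible_generators_S:
  "A \<in> compatible_generators S \<longleftrightarrow> A \<subseteq> carrier S \<and> finite A \<and> A \<noteq> {} \<and> pbij (Rel A)"
proof -
  have "(\<forall>a\<in>A. \<forall>b\<in>A. sg_compatible S a b) \<longleftrightarrow> pbij (Rel A)" if A: "A \<subseteq> carrier S"
  proof -
    define K where "K = {a \<in> PM. \<theta> a \<in> A}"
    have "A = \<theta> ` K" using carrier_S_E[OF _ A] by (auto simp: K_def)
    then have "(\<forall>a\<in>A. \<forall>b\<in>A. sg_compatible S a b) \<longleftrightarrow> (\<forall>a\<in>K. \<forall>b\<in>K. sg_compatible S (\<theta> a) (\<theta> b))"
      by simp
    also have "\<dots> \<longleftrightarrow> (\<forall>a\<in>K. \<forall>b\<in>K. (rel a)\<inverse> O rel b \<subseteq> Id \<and> rel a O (rel b)\<inverse> \<subseteq> Id)"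
      by (simp add: K_def compatible_S)
    also have "\<dots> \<longleftrightarrow> (Rel A)\<inverse> O Rel A \<subseteq> Id \<and> Rel A O (Rel A)\<inverse> \<subseteq> Id"
    proof -
      have "Rel A = \<Union> (rel ` K)" by (simp add: Rel_def K_def)
      then show ?thesis
        by (simp only: converse_UNION relcomp_UNION_distrib relcomp_UNION_distrib2 UN_subset_iff) blast
    qed
    also have "\<dots> \<longleftrightarrow> pbij (Rel A)"
      by (simp add: pbij_iff_Id)
    finally show ?thesis .
  qed
  then show ?thesis unfolding compatible_generators_def by auto
qed

lemma Rel_order_ideal: "A \<subseteq> carrier S \<Longrightarrow> Rel (order_ideal S A) = Rel A"
proof
  assume A: "A \<subseteq> carrier S"
  show "Rel (order_ideal S A) \<subseteq> Rel A"
  proof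
    fix p assume "p \<in> Rel (order_ideal S A)"
    then obtain a x where a: "a \<in> PM" "p \<in> rel a" "x \<in> A" "natural_le S (\<theta> a) x"
      unfolding Rel_def order_ideal_def by auto
    obtain b where "b \<in> PM" "x = \<theta> b" using a(3) A by (auto simp: carrier_S)
    then show "p \<in> Rel A" using a natural_le_S unfolding Rel_def by blast
  qed
  show "Rel A \<subseteq> Rel (order_ideal S A)"
    unfolding Rel_def order_ideal_def using natural_le_S by blast
qed

lemma Rel_set_mult:
  assumes "A \<subseteq> carrier S" "B \<subseteq> carrier S"
  shows "Rel (A <#>\<^bsub>S\<^esub> B) = Rel A O Rel B"
proof
  show "Rel (A <#>\<^bsub>S\<^esub> B) \<subseteq> Rel A O Rel B"
  proof
    fix p assume "p \<in> Rel (A <#>\<^bsub>S\<^esub> B)"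
    then obtain c x y where c: "c \<in> PM" "p \<in> rel c" "x \<in> A" "y \<in> B" "\<theta> c = x \<otimes>\<^bsub>S\<^esub> y"
      unfolding Rel_def set_mult_def by auto
    obtain a b where ab: "a \<in> PM" "b \<in> PM" "x = \<theta> a" "y = \<theta> b"
      using carrier_S_E[OF c(3) assms(1)] carrier_S_E[OF c(4) assms(2)] by metis
    then have "c = pmult a b" using c by (simp add: theta_mult theta_eq pmult_PM)
    then have "p \<in> rel a O rel b" using c(2) rel_pmult[OF ab(1,2)] by simp
    moreover have "rel a \<subseteq> Rel A" "rel b \<subseteq> Rel B" using ab c by (simp_all add: rel_subset_Rel)
    ultimately show "p \<in> Rel A O Rel B" using relcomp_mono by fast
  qed
  show "Rel A O Rel B \<subseteq> Rel (A <#>\<^bsub>S\<^esub> B)"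
  proof
    fix p assume "p \<in> Rel A O Rel B"
    then obtain y x z where p: "p = (y, z)" "(y, x) \<in> Rel A" "(x, z) \<in> Rel B" by blast
    then obtain a b where ab: "a \<in> PM" "b \<in> PM" "\<theta> a \<in> A" "\<theta> b \<in> B"
      and "(y, x) \<in> rel a" "(x, z) \<in> rel b"
      unfolding Rel_def by auto
    then have "p \<in> rel (pmult a b)" using p by (auto simp: rel_pmult)
    moreover have "\<theta> (pmult a b) \<in> A <#>\<^bsub>S\<^esub> B"
      using ab theta_mult[OF ab(1,2)] unfolding set_mult_def by blast
    ultimately show "p \<in> Rel (A <#>\<^bsub>S\<^esub> B)"
      using rel_subset_Rel[OF pmult_PM[OF ab(1,2)]] by blast
  qed
qed

lemma set_mult_carrier: "A \<subseteq> carrier S \<Longrightarrow> B \<subseteq> carrier S \<Longrightarrow> A <#>\<^bsub>S\<^esub> B \<subseteq> carrier S"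
  unfolding set_mult_def using mult_closed by blast

lemma mem_order_ideal:
  "A \<subseteq> carrier S \<Longrightarrow> a \<in> PM \<Longrightarrow> \<theta> a \<in> order_ideal S A \<longleftrightarrow> (\<exists>b\<in>PM. \<theta> b \<in> A \<and> rel a \<subseteq> rel b)"
  unfolding order_ideal_def using natural_le_S by (fastforce simp: carrier_S)

lemma order_ideal_carrier: "order_ideal S A \<subseteq> carrier S"
  unfolding order_ideal_def natural_le_def by blast

text \<open>An element below a product \<open>s t\<close> has the form \<open>s t e\<close> with
  \<open>e\<close> idempotent, and \<open>e\<close> is absorbed into the second factor:
  \<open>t e\<close> lies below \<open>t\<close>.\<close>

lemma order_ideal_mult:
  assumes "A \<subseteq> carrier S" "B \<subseteq> carrier S"
  shows "order_ideal S A <#>\<^bsub>S\<^esub> order_ideal S B = order_ideal S (A <#>\<^bsub>S\<^esub> B)"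
proof
  show "order_ideal S A <#>\<^bsub>S\<^esub> order_ideal S B \<subseteq> order_ideal S (A <#>\<^bsub>S\<^esub> B)"
  proof
    fix x assume "x \<in> order_ideal S A <#>\<^bsub>S\<^esub> order_ideal S B"
    then obtain y z where yz: "y \<in> order_ideal S A" "z \<in> order_ideal S B" "x = y \<otimes>\<^bsub>S\<^esub> z"
      unfolding set_mult_def by blast
    obtain c d where cd: "c \<in> PM" "d \<in> PM" "y = \<theta> c" "z = \<theta> d"
      using carrier_S_E[OF yz(1) order_ideal_carrier] carrier_S_E[OF yz(2) order_ideal_carrier] by metis
    then obtain a b where ab: "a \<in> PM" "b \<in> PM" "\<theta> a \<in> A" "\<theta> b \<in> B" "rel c \<subseteq> rel a" "rel d \<subseteq> rel b"
      using yz assms mem_order_ideal by metis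
    have "\<theta> (pmult a b) \<in> A <#>\<^bsub>S\<^esub> B"
      using ab theta_mult unfolding set_mult_def by force
    moreover have "rel (pmult c d) \<subseteq> rel (pmult a b)" using ab cd by (auto simp: rel_pmult)
    ultimately have "\<theta> (pmult c d) \<in> order_ideal S (A <#>\<^bsub>S\<^esub> B)"
      using mem_order_ideal[OF set_mult_carrier[OF assms] pmult_PM[OF cd(1,2)]] pmult_PM[OF ab(1,2)]
      by blast
    then show "x \<in> order_ideal S (A <#>\<^bsub>S\<^esub> B)" using yz cd theta_mult by simp
  qed
  show "order_ideal S (A <#>\<^bsub>S\<^esub> B) \<subseteq> order_ideal S A <#>\<^bsub>S\<^esub> order_ideal S B"
  proof
    fix x assume x: "x \<in> order_ideal S (A <#>\<^bsub>S\<^esub> B)"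
    then obtain s t where st: "s \<in> A" "t \<in> B" "natural_le S x (s \<otimes>\<^bsub>S\<^esub> t)"
      unfolding order_ideal_def set_mult_def by blast
    obtain a b where ab: "a \<in> PM" "b \<in> PM" "s = \<theta> a" "t = \<theta> b"
      using carrier_S_E[OF st(1) assms(1)] carrier_S_E[OF st(2) assms(2)] by metis
    have "natural_le S x (\<theta> (pmult a b))" using st ab theta_mult by simp
    then obtain c where c: "c \<in> PM" "x = \<theta> c" "rel c \<subseteq> rel (pmult a b)"
      using pmult_PM[OF ab(1,2)] by (auto elim: natural_leE)
    then obtain e where e: "e \<in> PM" "pmult e e = e" "c = pmult (pmult a b) e"
      using le_iff[OF c(1) pmult_PM[OF ab(1,2)]] by blast
    have "rel e \<subseteq> Id" using pmult_idem_iff e by blast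
    have "x = \<theta> a \<otimes>\<^bsub>S\<^esub> \<theta> (pmult b e)"
      using c e ab by (simp add: theta_mult pmult_PM pmult_assoc)
    moreover have "\<theta> a \<in> order_ideal S A"
      using mem_order_ideal[OF assms(1)] ab st by blast
    moreover have "\<theta> (pmult b e) \<in> order_ideal S B"
    proof -
      have "rel (pmult b e) \<subseteq> rel b" using \<open>rel e \<subseteq> Id\<close> e ab by (auto simp: rel_pmult)
      then show ?thesis using mem_order_ideal[OF assms(2) pmult_PM[OF ab(2) e(1)]] ab st by blast
    qed
    ultimately show "x \<in> order_ideal S A <#>\<^bsub>S\<^esub> order_ideal S B" unfolding set_mult_def by blast
  qed
qed

lemma carrier_FC: "carrier (finitary_completion S) = order_ideal S ` compatible_generators S"
  by (simp add: finitary_completion_def)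

lemma compatible_generators_carrier: "A \<in> compatible_generators S \<Longrightarrow> A \<subseteq> carrier S"
  by (simp add: compatible_generators_S)

lemma compatible_generators_mult:
  assumes "A \<in> compatible_generators S" "B \<in> compatible_generators S"
  shows "A <#>\<^bsub>S\<^esub> B \<in> compatible_generators S"
proof -
  have "A <#>\<^bsub>S\<^esub> B = (\<lambda>(a, b). a \<otimes>\<^bsub>S\<^esub> b) ` (A \<times> B)" unfolding set_mult_def by auto
  then have "finite (A <#>\<^bsub>S\<^esub> B) \<and> A <#>\<^bsub>S\<^esub> B \<noteq> {}" using assms by (simp add: compatible_generators_S)
  moreover have "pbij (Rel (A <#>\<^bsub>S\<^esub> B))"
    using assms by (simp add: compatible_generators_S Rel_set_mult pbij_comp)
  moreover have "A <#>\<^bsub>S\<^esub> B \<subseteq> carrier S"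
    using assms by (intro set_mult_carrier) (simp_all add: compatible_generators_S)
  ultimately show ?thesis by (simp add: compatible_generators_S)
qed

abbreviation closed_rel :: "'a set \<Rightarrow> (nat list \<times> nat list) set" where
  "closed_rel I \<equiv> cl (Rel I)"

lemma completion_rel_S: "completion_rel S = kernel_rel (finitary_completion S) closed_rel"
proof -
  have "biarrow S A B \<longleftrightarrow> closed_rel (order_ideal S A) = closed_rel (order_ideal S B)"
    if "A \<in> compatible_generators S" "B \<in> compatible_generators S" for A B
    using that[THEN compatible_generators_carrier] by (simp add: biarrow_S Rel_order_ideal)
  then show ?thesis
    unfolding completion_rel_def kernel_rel_def carrier_FC by blast
qed

lemma FC_closed:
  "I \<in> carrier (finitary_completion S) \<Longrightarrow> J \<in> carrier (finitary_completion S) \<Longrightarrow>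
    I \<otimes>\<^bsub>finitary_completion S\<^esub> J \<in> carrier (finitary_completion S)"
  unfolding carrier_FC
  by (auto simp: finitary_completion_def order_ideal_mult compatible_generators_carrier compatible_generators_mult)

lemma Rel_gen:
  assumes "A \<subseteq> carrier S"
  shows "Rel A = gen {p. Some p \<in> PM \<and> \<theta> (Some p) \<in> A}"
proof -
  have "rel a = (\<Union>p\<in>{p. a = Some p}. gen {p})" for a
    by (simp add: rel_def split: option.split)
  then have "Rel A = (\<Union>a\<in>{a\<in>PM. \<theta> a \<in> A}. \<Union>p\<in>{p. a = Some p}. gen {p})"
    unfolding Rel_def by simp
  then show ?thesis unfolding gen_UN[of "Collect _"] by blast
qed

lemma closed_rel_image: "closed_rel ` carrier (finitary_completion S) = carrier model"
proof
  show "closed_rel ` carrier (finitary_completion S) \<subseteq> carrier model"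
  proof
    fix R assume "R \<in> closed_rel ` carrier (finitary_completion S)"
    then obtain A where A: "A \<in> compatible_generators S" "R = closed_rel (order_ideal S A)"
      unfolding carrier_FC by blast
    then have A': "A \<subseteq> carrier S" "finite A" "pbij (Rel A)" "R = cl (Rel A)"
      by (auto simp: compatible_generators_S Rel_order_ideal)
    let ?F = "{p. Some p \<in> PM \<and> \<theta> (Some p) \<in> A}"
    have "inj_on (\<lambda>p. \<theta> (Some p)) ?F" by (auto intro!: inj_onI simp: theta_eq)
    then have "finite ?F" using A'(2) by (auto elim!: inj_on_finite)
    moreover have "?F \<subseteq> W \<times> W" by (auto simp: PM_Some)
    ultimately show "R \<in> carrier model" using A' Rel_gen[OF A'(1)] modelI by simp
  qed
  show "carrier model \<subseteq> closed_rel ` carrier (finitary_completion S)"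
  proof
    fix R assume "R \<in> carrier model"
    then obtain F where F: "finite F" "F \<subseteq> W \<times> W" "pbij (gen F)" "R = cl (gen F)"
      by (auto elim: modelE)
    \<comment> \<open>Generating sets must be non-empty, so zero is added to cover an empty
      \<open>F\<close>; its graph is empty and leaves \<open>Rel\<close> unchanged.\<close>
    let ?A = "\<theta> ` insert None (Some ` F)"
    have PM: "insert None (Some ` F) \<subseteq> PM" using F(2) by (auto simp: PM_def)
    then have A: "?A \<subseteq> carrier S" by (auto simp: theta_PM)
    have "{p. Some p \<in> PM \<and> \<theta> (Some p) \<in> ?A} = F"
      using PM by (auto simp: theta_eq subset_iff)
    then have "Rel ?A = gen F" using Rel_gen[OF A] by simp
    then have "?A \<in> compatible_generators S" "R = closed_rel (order_ideal S ?A)"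
      using F A by (simp_all add: compatible_generators_S Rel_order_ideal del: image_insert)
    then show "R \<in> closed_rel ` carrier (finitary_completion S)" unfolding carrier_FC by blast
  qed
qed

lemma closed_rel_hom: "closed_rel \<in> hom (finitary_completion S) model"
proof (rule homI)
  fix I J assume "I \<in> carrier (finitary_completion S)" "J \<in> carrier (finitary_completion S)"
  then have IJ: "I \<subseteq> carrier S" "J \<subseteq> carrier S"
    unfolding carrier_FC using order_ideal_carrier by blast+
  have "closed_rel (I \<otimes>\<^bsub>finitary_completion S\<^esub> J) = cl (Rel I O Rel J)"
    using IJ by (simp add: finitary_completion_def Rel_set_mult)
  also have "\<dots> = cl (closed_rel I O closed_rel J)"
    by (rule cl_comp[symmetric]) (rule rideal_Rel)+
  finally show "closed_rel (I \<otimes>\<^bsub>finitary_completion S\<^esub> J) = closed_rel I \<otimes>\<^bsub>model\<^esub> closed_rel J" by simp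
qed (use closed_rel_image in blast)

lemma completion_iso:
  "\<exists>h \<in> iso model (quotient_semigroup (finitary_completion S) (completion_rel S)).
     h \<one>\<^bsub>model\<^esub> = \<one>\<^bsub>quotient_semigroup (finitary_completion S) (completion_rel S)\<^esub>"
proof -
  have 1: "{\<one>\<^bsub>S\<^esub>} \<in> compatible_generators S" "closed_rel (order_ideal S {\<one>\<^bsub>S\<^esub>}) = \<one>\<^bsub>model\<^esub>"
    using theta_PM[OF one_PM]
    by (simp_all add: one[symmetric] compatible_generators_S Rel_order_ideal Rel_single pbij_rel)
      (simp add: rel_def gen_one cl_one)
  have "\<one>\<^bsub>finitary_completion S\<^esub> \<in> carrier (finitary_completion S)"
    "closed_rel \<one>\<^bsub>finitary_completion S\<^esub> = \<one>\<^bsub>model\<^esub>"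
    using 1 by (simp_all add: finitary_completion_def)
  from kernel_quotient_iso[OF closed_rel_hom closed_rel_image FC_closed this]
  show ?thesis unfolding completion_rel_S by blast
qed

end

context polycyclic
begin

lemma cuntz_iso: "\<exists>h \<in> iso model (cuntz_monoid n). h \<one>\<^bsub>model\<^esub> = \<one>\<^bsub>cuntz_monoid n\<^esub>"
proof -
  interpret P: polycyclic_copy n "polycyclic_monoid n" "fibre FM pm_of"
    using polycyclic_monoid_iso by unfold_locales auto
  interpret Q: polycyclic_copy n "quotient_semigroup (polycyclic_monoid n) (biarrow_rel (polycyclic_monoid n))"
    "fibre (polycyclic_monoid n) id \<circ> fibre FM pm_of"
    by (rule P.quotient_copy)
  show ?thesis
    using Q.completion_iso unfolding cuntz_monoid_def distributive_completion_def Let_def .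
qed

end

section \<open>Transport along isomorphisms\<close>

lemma congruence_free_iso:
  assumes h: "h \<in> iso M Q" and cf: "congruence_free M"
    and closed: "\<And>x y. x \<in> carrier M \<Longrightarrow> y \<in> carrier M \<Longrightarrow> x \<otimes>\<^bsub>M\<^esub> y \<in> carrier M"
  shows "congruence_free Q"
  unfolding congruence_free_def
proof (intro allI impI)
  fix r assume r: "semigroup_congruence Q r"
  have eq: "equiv (carrier Q) r" using r unfolding semigroup_congruence_def by blast
  have inj: "inj_on h (carrier M)" and im: "carrier Q = h ` carrier M"
    and hom: "\<And>x y. x \<in> carrier M \<Longrightarrow> y \<in> carrier M \<Longrightarrow> h (x \<otimes>\<^bsub>M\<^esub> y) = h x \<otimes>\<^bsub>Q\<^esub> h y"
    using h by (auto simp: iso_def bij_betw_def hom_def)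
  have rQ: "r \<subseteq> h ` carrier M \<times> h ` carrier M"
    using equiv_type[OF eq] im by simp
  define r' where "r' = {(a, b). a \<in> carrier M \<and> b \<in> carrier M \<and> (h a, h b) \<in> r}"
  have "equiv (carrier M) r'"
  proof (rule equivI)
    show "refl_on (carrier M) r'" "r' \<subseteq> carrier M \<times> carrier M"
      using eq im by (auto simp: r'_def equiv_def refl_on_def)
    show "sym r'" using eq by (auto simp: r'_def equiv_def sym_def)
    show "trans r'" using eq unfolding r'_def equiv_def trans_def by blast
  qed
  moreover have "(a \<otimes>\<^bsub>M\<^esub> c, b \<otimes>\<^bsub>M\<^esub> d) \<in> r'" if "(a, b) \<in> r'" "(c, d) \<in> r'" for a b c d
  proof -
    have "(h a \<otimes>\<^bsub>Q\<^esub> h c, h b \<otimes>\<^bsub>Q\<^esub> h d) \<in> r"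
      using that r unfolding r'_def semigroup_congruence_def by blast
    then show ?thesis using that hom closed by (auto simp: r'_def)
  qed
  ultimately have "semigroup_congruence M r'" unfolding semigroup_congruence_def by blast
  then have "r' = Id_on (carrier M) \<or> r' = carrier M \<times> carrier M"
    using cf unfolding congruence_free_def by blast
  moreover have "r = map_prod h h ` r'"
    using rQ by (force simp: r'_def)
  moreover have "map_prod h h ` Id_on (carrier M) = Id_on (carrier Q)"
    unfolding im by force
  moreover have "map_prod h h ` (carrier M \<times> carrier M) = carrier Q \<times> carrier Q"
    unfolding im by (simp add: map_prod_surj_on)
  ultimately show "r = Id_on (carrier Q) \<or> r = carrier Q \<times> carrier Q" by metis
qed

text \<open>\<open>Units\<close> refers to the \<open>one\<close> component of the record, which
  \<open>iso\<close> leaves free; the second assumption supplies it.\<close>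

lemma units_of_iso:
  assumes h: "h \<in> iso M Q" "h \<one>\<^bsub>M\<^esub> = \<one>\<^bsub>Q\<^esub>" and M: "monoid M"
  shows "units_of Q \<cong> units_of M"
proof -
  interpret monoid M by fact
  have inj: "inj_on h (carrier M)" and im: "carrier Q = h ` carrier M"
    and hom: "\<And>x y. x \<in> carrier M \<Longrightarrow> y \<in> carrier M \<Longrightarrow> h (x \<otimes>\<^bsub>M\<^esub> y) = h x \<otimes>\<^bsub>Q\<^esub> h y"
    using h by (auto simp: iso_def bij_betw_def hom_def)
  have one: "h x \<otimes>\<^bsub>Q\<^esub> h y = \<one>\<^bsub>Q\<^esub> \<longleftrightarrow> x \<otimes>\<^bsub>M\<^esub> y = \<one>\<^bsub>M\<^esub>" if "x \<in> carrier M" "y \<in> carrier M" for x y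
    using that inj h(2) by (metis hom inj_on_eq_iff m_closed one_closed)
  have units: "Units Q = h ` Units M"
    unfolding Units_def im by (auto simp: one intro!: imageI)
  have "h \<in> iso (units_of M) (units_of Q)"
    unfolding iso_def hom_def bij_betw_def
    using units inj_on_subset[OF inj, of "Units M"] hom Units_closed
    by (auto simp: units_of_carrier units_of_mult)
  then have "units_of M \<cong> units_of Q" by (rule is_isoI)
  then show ?thesis by (rule group.iso_sym[OF units_group])
qed

context polycyclic
begin

section \<open>Congruence-freeness\<close>

text \<open>The graph of \<open>y\<^sup>-\<^sup>1 R x\<close>; multiplying by
  \<open>y\<^sup>-\<^sup>1\<close> and \<open>x\<close> removes the prefixes \<open>y\<close> and
  \<open>x\<close> from the pairs that have them.\<close>

definition slice :: "nat list \<Rightarrow> nat list \<Rightarrow> (nat list \<times> nat list) set \<Rightarrow> (nat list \<times> nat list) set" where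
  "slice y x R = {(v, u). (y @ v, x @ u) \<in> R}"

lemma cl_empty: "cl {} = {}"
  by (auto dest: clD0)

lemma gen1_model:
  assumes "y \<in> W" "x \<in> W"
  shows "gen {(y, x)} \<in> carrier model"
proof -
  have "cl (gen {(y, x)}) \<in> carrier model"
    using assms pbij_rel[of "Some (y, x)"] by (intro modelI) (auto simp: rel_def)
  moreover have "cl (gen {(y, x)}) = gen {(y, x)}"
    using cl_rel[of "Some (y, x)"] assms by (simp add: rel_def PM_Some)
  ultimately show ?thesis by simp
qed

lemma rideal_slice:
  assumes "rideal R"
  shows "rideal (slice y x R)"
  unfolding rideal_def
proof (intro conjI allI impI subrelI)
  fix v u assume "(v, u) \<in> slice y x R"
  then show "(v, u) \<in> W \<times> W"
    using rideal_W[OF assms, of "y @ v" "x @ u"] by (simp add: slice_def)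
next
  fix v u w assume "(v, u) \<in> slice y x R" "w \<in> W"
  then show "(v @ w, u @ w) \<in> slice y x R"
    using rideal_app[OF assms, of "y @ v" "x @ u" w] by (simp add: slice_def)
qed

lemma slice_mult:
  assumes "R \<in> carrier model" "y \<in> W" "x \<in> W"
  shows "gen {([], y)} \<otimes>\<^bsub>model\<^esub> R \<otimes>\<^bsub>model\<^esub> gen {(x, [])} = cl (slice y x R)"
proof -
  have r: "rideal R" "cl R = R" using assms model_rideal model_cl by auto
  have r2: "rideal (gen {([], y)})" "rideal (gen {(x, [])})"
    using assms by (auto intro!: rideal_gen)
  have c: "cl (gen {(x, [])}) = gen {(x, [])}"
    using cl_rel[of "Some (x, [])"] assms by (simp add: rel_def PM_Some)
  have "(v, u) \<in> gen {([], y)} O R O gen {(x, [])} \<longleftrightarrow> (v, u) \<in> slice y x R" for v u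
  proof -
    have "(v, u) \<in> gen {([], y)} O R O gen {(x, [])} \<longleftrightarrow> v \<in> W \<and> u \<in> W \<and> (y @ v, x @ u) \<in> R"
      unfolding relcomp_unfold by (auto simp: mem_gen1)
    also have "\<dots> \<longleftrightarrow> (v, u) \<in> slice y x R"
      using rideal_W[OF r(1), of "y @ v" "x @ u"] by (auto simp: slice_def)
    finally show ?thesis .
  qed
  then have "gen {([], y)} O R O gen {(x, [])} = slice y x R" by auto
  then show ?thesis
    using cl_comp[OF rideal_comp[OF r2(1) r(1)] r2(2)] c by (simp add: O_assoc)
qed

text \<open>By right-invariance \<open>R\<close> contains \<open>(y @ v, x @ v)\<close>, and by
  bijectivity \<open>y @ v\<close> has no other partner. So the slice is already the identity before
  closing.\<close>

lemma slice_one: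
  assumes "R \<in> carrier model" "(y, x) \<in> R"
  shows "cl (slice y x R) = Id_on W"
proof -
  have r: "rideal R" "pbij R" using assms model_rideal model_pbij by auto
  have yx: "(y @ v, x @ v) \<in> R" if "v \<in> W" for v using rideal_app[OF r(1) assms(2) that] .
  have "(v, u) \<in> slice y x R \<longleftrightarrow> (v, u) \<in> Id_on W" for v u
  proof
    assume vu: "(v, u) \<in> slice y x R"
    then have "v \<in> W" using rideal_W[OF r(1)] by (force simp: slice_def)
    from yx[OF this] vu have "x @ u = x @ v"
      using r(2) unfolding pbij_iff slice_def by blast
    with \<open>v \<in> W\<close> show "(v, u) \<in> Id_on W" by auto
  next
    assume "(v, u) \<in> Id_on W"
    then show "(v, u) \<in> slice y x R" using yx by (auto simp: slice_def)
  qed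
  then have "slice y x R = Id_on W" by auto
  then show ?thesis by (simp add: cl_one)
qed

text \<open>If \<open>q\<close> is \<open>p\<close> followed by a letter \<open>i\<close> and more,
  appending a letter other than \<open>i\<close> to both words makes them differ immediately after
  \<open>p\<close>. Two letters suffice.\<close>

lemma make_incomparable:
  assumes "p \<noteq> q"
  shows "\<exists>w\<in>W. \<not> prefix (p @ w) (q @ w) \<and> \<not> prefix (q @ w) (p @ w)"
proof -
  have *: "\<exists>w\<in>W. \<not> prefix (p @ w) (q @ w) \<and> \<not> prefix (q @ w) (p @ w)" if "p \<noteq> q" "prefix p q" for p q
  proof -
    obtain i t where q: "q = p @ i # t" using \<open>p \<noteq> q\<close> \<open>prefix p q\<close> unfolding prefix_def
      by (metis append_Nil2 list.exhaust)
    define j where "j = (if i = 0 then 1 else 0 :: nat)"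
    have "j \<noteq> i" "[j] \<in> W" using n2 by (auto simp: j_def)
    then show ?thesis using q by (intro bexI[of _ "[j]"]) auto
  qed
  show ?thesis
  proof (cases "prefix p q \<or> prefix q p")
    case True
    then show ?thesis using *[of p q] *[of q p] assms by blast
  next
    case False
    then show ?thesis by (intro bexI[of _ "[]"]) auto
  qed
qed

lemma congruence_free_model: "congruence_free model"
  unfolding congruence_free_def
proof (intro allI impI)
  fix r assume r: "semigroup_congruence model r"
  have eq: "equiv (carrier model) r" using r unfolding semigroup_congruence_def by blast
  have refl: "(a, a) \<in> r" if "a \<in> carrier model" for a
    using eq that unfolding equiv_def refl_on_def by blast
  have sym: "(b, a) \<in> r" if "(a, b) \<in> r" for a b using eq that by (meson equiv_def symD)
  have trans: "(a, c) \<in> r" if "(a, b) \<in> r" "(b, c) \<in> r" for a b c using eq that by (meson equiv_def transD)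
  have cong: "(a \<otimes>\<^bsub>model\<^esub> c, b \<otimes>\<^bsub>model\<^esub> d) \<in> r" if "(a, b) \<in> r" "(c, d) \<in> r" for a b c d
    using r that unfolding semigroup_congruence_def by blast
  have rsub: "a \<in> carrier model \<and> b \<in> carrier model" if "(a, b) \<in> r" for a b
    using equiv_type[OF eq] that by blast
  have slices: "(cl (slice y x a), cl (slice y x b)) \<in> r" if "(a, b) \<in> r" "y \<in> W" "x \<in> W" for a b y x
    using cong[OF cong[OF refl[OF gen1_model[of "[]" y]] that(1)] refl[OF gen1_model[of x "[]"]]]
      rsub[OF that(1)] that(2,3) slice_mult by simp
  have separated: "(Id_on W, {}) \<in> r"
    if ab: "(a, b) \<in> r" and yx: "(y, x) \<in> a" and notb: "\<And>z. z \<in> W \<Longrightarrow> (y @ z, x @ z) \<notin> b" for a b y x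
  proof -
    have M: "a \<in> carrier model" "b \<in> carrier model" using rsub[OF ab] by auto
    have W: "y \<in> W" "x \<in> W" using rideal_W[OF model_rideal[OF M(1)] yx] by auto
    have 1: "(Id_on W, cl (slice y x b)) \<in> r"
      using slices[OF ab W] slice_one[OF M(1) yx] by simp
    show ?thesis
    proof (cases "slice y x b = {}")
      case True
      then show ?thesis using 1 by (simp add: cl_empty)
    next
      case False
      then obtain p q where pq: "(y @ p, x @ q) \<in> b" unfolding slice_def by auto
      have pqW: "p \<in> W" "q \<in> W" using rideal_W[OF model_rideal[OF M(2)] pq] by auto
      \<comment> \<open>A diagonal pair of the slice would be an extension of \<open>(y, x)\<close>
        inside \<open>b\<close>.\<close>
      have "p \<noteq> q" using notb pq pqW by blast
      then obtain w where w: "w \<in> W" "\<not> prefix (p @ w) (q @ w)" "\<not> prefix (q @ w) (p @ w)"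
        using make_incomparable by blast
      have c: "cl (slice y x b) \<in> carrier model" using rsub[OF 1] by blast
      have "rideal (slice y x b)" using rideal_slice[OF model_rideal[OF M(2)]] .
      moreover have "(p @ w, q @ w) \<in> slice y x b"
        using rideal_app[OF model_rideal[OF M(2)] pq w(1)] by (simp add: slice_def)
      ultimately have "(p @ w, q @ w) \<in> cl (slice y x b)" using cl_incl by blast
      then have "cl (slice (p @ w) (q @ w) (cl (slice y x b))) = Id_on W" by (rule slice_one[OF c])
      \<comment> \<open>A pair in this slice of the identity would give \<open>p @ w\<close> and
        \<open>q @ w\<close> a common extension. So this second multiplication sends
        \<open>1\<close> to \<open>0\<close>, while it sends the other element to
        \<open>1\<close>.\<close>
      moreover have "slice (p @ w) (q @ w) (Id_on W) = {}"
        using w by (auto simp: slice_def) (metis append_assoc prefixI prefix_same_cases)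
      ultimately have "({}, Id_on W) \<in> r"
        using slices[OF 1, of "p @ w" "q @ w"] pqW w(1) by (simp add: cl_empty)
      then show ?thesis by (rule sym)
    qed
  qed
  have distinct: "(Id_on W, {}) \<in> r" if ab: "(a, b) \<in> r" and nsub: "\<not> a \<subseteq> b" for a b
  proof -
    have M: "a \<in> carrier model" "b \<in> carrier model" using rsub[OF ab] by auto
    obtain y x where yx: "(y, x) \<in> a" "(y, x) \<notin> cl b" using nsub model_cl[OF M(2)] by auto
    have "y \<in> W" "x \<in> W" using rideal_W[OF model_rideal[OF M(1)] yx(1)] by auto
    \<comment> \<open>As \<open>b\<close> is closed and misses \<open>(y, x)\<close>, some
      \<open>w\<close> admits no further extension into \<open>b\<close>. The pair passed to
      \<open>separated\<close> is therefore \<open>(y @ w, x @ w)\<close>.\<close>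
    with yx(2) obtain w where w: "w \<in> W" "\<And>z. z \<in> W \<Longrightarrow> (y @ w @ z, x @ w @ z) \<notin> b"
      using clI[of y x b] by blast
    show ?thesis
      by (rule separated[OF ab rideal_app[OF model_rideal[OF M(1)] yx(1) w(1)]]) (use w(2) in simp)
  qed
  show "r = Id_on (carrier model) \<or> r = carrier model \<times> carrier model"
  proof (cases "\<exists>a b. (a, b) \<in> r \<and> a \<noteq> b")
    case True
    then have "(Id_on W, {}) \<in> r" using distinct sym by blast
    \<comment> \<open>Multiplying the pair \<open>(1, 0)\<close> by \<open>a\<close> relates every
      \<open>a\<close> to zero.\<close>
    then have "(a, {}) \<in> r" if "a \<in> carrier model" for a
      using cong[OF refl[OF that]] that by (fastforce simp: W_comp model_rideal model_cl cl_empty)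
    then have "(a, b) \<in> r" if "a \<in> carrier model" "b \<in> carrier model" for a b
      using that sym trans by blast
    then show ?thesis using rsub by auto
  next
    case False
    then have "r = Id_on (carrier model)" using refl rsub by (auto simp: Id_on_iff)
    then show ?thesis ..
  qed
qed

section \<open>The group of units\<close>

definition long :: "nat list set \<Rightarrow> bool" where
  "long D \<longleftrightarrow> (\<exists>N. \<forall>w\<in>W. N \<le> length w \<longrightarrow> w \<in> D)"

lemma long_mono: "long D \<Longrightarrow> D \<subseteq> E \<Longrightarrow> long E"
  unfolding long_def by blast

lemma replicate_W: "replicate N 0 \<in> W"
  using n2 by (auto simp: in_lists_conv_set)

text \<open>Any word of length \<open>N\<close> will do, so one \<open>z\<close> serves all
  \<open>x\<close> at once; \<open>maximal_isos_iff\<close> relies on this uniformity.\<close>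

lemma long_extend:
  assumes "long D"
  shows "\<exists>z\<in>W. \<forall>x\<in>W. x @ z \<in> D"
proof -
  obtain N where N: "\<forall>w\<in>W. N \<le> length w \<longrightarrow> w \<in> D" using assms unfolding long_def by blast
  show ?thesis using N replicate_W by (intro bexI[of _ "replicate N 0"] ballI) auto
qed

text \<open>Let \<open>N\<close> bound the lengths in \<open>P\<close>. A word \<open>x\<close> of
  length at least \<open>N\<close> has an extension beginning with some \<open>p \<in> P\<close>,
  and since \<open>p\<close> is not longer than \<open>x\<close>, it is a prefix of
  \<open>x\<close>.\<close>

lemma dense_fg_long:
  assumes P: "finite P" "(\<Union>p\<in>P. (\<lambda>w. p @ w) ` W) \<subseteq> D" and dense: "\<And>x. x \<in> W \<Longrightarrow> \<exists>z. x @ z \<in> (\<Union>p\<in>P. (\<lambda>w. p @ w) ` W)"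
  shows "long D"
proof -
  obtain N where N: "\<forall>k\<in>length ` P. k \<le> N"
    using P(1) finite_nat_set_iff_bounded_le by blast
  have "x \<in> D" if x: "x \<in> W" "N \<le> length x" for x
  proof -
    obtain z p t where p: "p \<in> P" "t \<in> W" "x @ z = p @ t" using dense[OF x(1)] by auto
    then have "length p \<le> length x" using N x(2) by fastforce
    then obtain s where "x = p @ s" using p(3) by (metis append_eq_append_conv_if append_take_drop_id)
    then show ?thesis using x(1) p(1) P(2) by auto
  qed
  then show ?thesis unfolding long_def by blast
qed

text \<open>Forwards, meeting the ideal \<open>x W\<close> is the density needed for
  \<open>dense_fg_long\<close>. Backwards, the members of length at most \<open>N\<close> generate
  \<open>D\<close>, because a longer member has its prefix of length \<open>N\<close> in
  \<open>D\<close>; and \<open>long_extend\<close> leads from any ideal into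
  \<open>D\<close>.\<close>

lemma fg_essential_iff:
  "fg_right_ideal n D \<and> essential_right_ideal n D \<longleftrightarrow> right_ideal n D \<and> long D"
proof (intro iffI conjI)
  assume D: "fg_right_ideal n D \<and> essential_right_ideal n D"
  then show "right_ideal n D" by (simp add: essential_right_ideal_def)
  obtain P where P: "finite P" "D = (\<Union>p\<in>P. (\<lambda>w. p @ w) ` W)"
    using D unfolding fg_right_ideal_def by blast
  show "long D"
  proof (rule dense_fg_long[OF P(1)])
    fix x assume x: "x \<in> W"
    have "right_ideal n ((\<lambda>w. x @ w) ` W)" using x unfolding right_ideal_def by auto
    moreover have "(\<lambda>w. x @ w) ` W \<noteq> {}" using lists.Nil by blast
    ultimately have "D \<inter> (\<lambda>w. x @ w) ` W \<noteq> {}"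
      using D unfolding essential_right_ideal_def by blast
    then obtain z where "x @ z \<in> D" by blast
    then show "\<exists>z. x @ z \<in> (\<Union>p\<in>P. (\<lambda>w. p @ w) ` W)" using P(2) by metis
  qed (simp add: P(2))
next
  assume D: "right_ideal n D \<and> long D"
  then have DW: "D \<subseteq> W" and app: "\<And>r w. r \<in> D \<Longrightarrow> w \<in> W \<Longrightarrow> r @ w \<in> D"
    unfolding right_ideal_def by auto
  obtain N where N: "\<forall>w\<in>W. N \<le> length w \<longrightarrow> w \<in> D" using D unfolding long_def by blast
  let ?P = "{w \<in> D. length w \<le> N}"
  have "finite ?P"
    by (rule finite_subset[OF _ finite_lists_length_le[of "{..<n}" N]])
      (use DW in \<open>auto simp: in_lists_conv_set\<close>)
  moreover have "w \<in> (\<Union>p\<in>?P. (\<lambda>w. p @ w) ` W)" if w: "w \<in> D" for w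
  proof (cases "length w \<le> N")
    case True
    then show ?thesis using w by (intro UN_I[of w]) (auto intro: image_eqI[of _ _ "[]"])
  next
    case False
    have "take N w @ drop N w \<in> W" using w DW by auto
    then have "take N w \<in> W" "drop N w \<in> W" by (simp_all only: append_in_lists_conv)
    then show ?thesis using N False
      by (intro UN_I[of "take N w"]) (auto intro: image_eqI[of _ _ "drop N w"])
  qed
  ultimately show "fg_right_ideal n D"
    unfolding fg_right_ideal_def using DW app by (intro exI[of _ ?P]) auto
  show "essential_right_ideal n D"
    unfolding essential_right_ideal_def
  proof (intro conjI allI impI)
    fix I assume I: "right_ideal n I \<and> I \<noteq> {}"
    then obtain x where x: "x \<in> I" "x \<in> W" unfolding right_ideal_def by blast
    obtain z where z: "z \<in> W" "\<forall>x\<in>W. x @ z \<in> D" using long_extend D by blast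
    then have "x @ z \<in> I" using I x unfolding right_ideal_def by blast
    then show "D \<inter> I \<noteq> {}" using z x by blast
  qed (use D in simp)
qed

section \<open>Isomorphisms between ideals as graphs\<close>

definition gr :: "(nat list \<rightharpoonup> nat list) \<Rightarrow> (nat list \<times> nat list) set" where
  "gr f = {(y, x). f x = Some y}"

definition fun_of :: "(nat list \<times> nat list) set \<Rightarrow> nat list \<rightharpoonup> nat list" where
  "fun_of R x = (if \<exists>y. (y, x) \<in> R then Some (THE y. (y, x) \<in> R) else None)"

definition big_iso :: "(nat list \<times> nat list) set \<Rightarrow> bool" where
  "big_iso R \<longleftrightarrow> rideal R \<and> pbij R \<and> long (Domain R) \<and> long (Range R)"

lemma gr_fun_of:
  assumes "pbij R"
  shows "gr (fun_of R) = R"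
proof -
  have "(THE y. (y, x) \<in> R) = y" if "(y, x) \<in> R" for y x
    using that assms unfolding pbij_iff by (intro the_equality) blast+
  then show ?thesis unfolding gr_def fun_of_def by (auto split: if_splits)
qed

lemma gr_le: "f \<subseteq>\<^sub>m g \<longleftrightarrow> gr f \<subseteq> gr g"
  unfolding map_le_def gr_def by (force simp: dom_def)

lemma gr_inj: "gr f = gr g \<Longrightarrow> f = g"
  by (simp add: gr_le map_le_antisym)

lemma fun_of_gr: "pbij (gr f) \<Longrightarrow> fun_of (gr f) = f"
  by (simp add: gr_fun_of gr_inj)

lemma gr_comp: "gr (f \<circ>\<^sub>m g) = gr f O gr g"
  unfolding gr_def map_comp_def by (auto split: option.splits)

lemma dom_gr: "dom f = Range (gr f)" "ran f = Domain (gr f)"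
  unfolding gr_def ran_def dom_def by auto

text \<open>By \<open>fg_essential_iff\<close> the conditions on domain and image become
  \<open>right_ideal\<close> and \<open>long\<close>; injectivity and equivariance of
  \<open>f\<close> correspond to \<open>pbij\<close> and right-invariance of its graph.\<close>

lemma ideal_isos_iff: "f \<in> ideal_isos n \<longleftrightarrow> big_iso (gr f)"
proof -
  have "f \<in> ideal_isos n \<longleftrightarrow> right_ideal n (dom f) \<and> long (dom f) \<and> right_ideal n (ran f) \<and> long (ran f) \<and>
     inj_on f (dom f) \<and> (\<forall>r\<in>dom f. \<forall>w\<in>W. f (r @ w) = Some (the (f r) @ w))"
    unfolding ideal_isos_def mem_Collect_eq using fg_essential_iff[of "dom f"] fg_essential_iff[of "ran f"] by argo
  also have "\<dots> \<longleftrightarrow> big_iso (gr f)"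
  proof
    assume a: "right_ideal n (dom f) \<and> long (dom f) \<and> right_ideal n (ran f) \<and> long (ran f) \<and>
     inj_on f (dom f) \<and> (\<forall>r\<in>dom f. \<forall>w\<in>W. f (r @ w) = Some (the (f r) @ w))"
    have "rideal (gr f)" unfolding rideal_def
    proof (intro conjI allI impI subrelI)
      fix y x assume "(y, x) \<in> gr f"
      then have "x \<in> dom f" "y \<in> ran f" by (auto simp: dom_gr)
      then show "(y, x) \<in> W \<times> W" using a unfolding right_ideal_def by auto
    next
      fix y x w assume "(y, x) \<in> gr f" "w \<in> W"
      then show "(y @ w, x @ w) \<in> gr f" using a unfolding gr_def by (auto simp: dom_def)
    qed
    moreover have "pbij (gr f)"
    proof -
      have "x = x'" if "f x = Some y" "f x' = Some y" for x x' y
        using a that by (metis domI inj_onD)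
      then show ?thesis unfolding pbij_iff gr_def by auto
    qed
    ultimately show "big_iso (gr f)" using a by (simp add: big_iso_def dom_gr)
  next
    assume b: "big_iso (gr f)"
    then have ri: "rideal (gr f)" and pb: "pbij (gr f)" by (simp_all add: big_iso_def)
    have "right_ideal n (dom f)" "right_ideal n (ran f)"
      unfolding right_ideal_def dom_gr using ri unfolding rideal_def by blast+
    moreover have "inj_on f (dom f)"
      using pb unfolding pbij_iff gr_def by (auto intro!: inj_onI simp: dom_def)
    moreover have "f (r @ w) = Some (the (f r) @ w)" if "r \<in> dom f" "w \<in> W" for r w
      using that rideal_app[OF ri, of "the (f r)" r w] by (auto simp: gr_def)
    ultimately show "right_ideal n (dom f) \<and> long (dom f) \<and> right_ideal n (ran f) \<and> long (ran f) \<and>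
     inj_on f (dom f) \<and> (\<forall>r\<in>dom f. \<forall>w\<in>W. f (r @ w) = Some (the (f r) @ w))"
      using b by (simp add: big_iso_def dom_gr)
  qed
  finally show ?thesis .
qed

lemma big_iso_cl:
  assumes "big_iso R"
  shows "big_iso (cl R)"
proof -
  have "R \<subseteq> cl R" using assms cl_incl by (simp add: big_iso_def)
  then have "Domain R \<subseteq> Domain (cl R)" "Range R \<subseteq> Range (cl R)" by auto
  then show ?thesis using assms rideal_cl pbij_cl long_mono unfolding big_iso_def by blast
qed

text \<open>The closure of a graph is the graph of an isomorphism extending it, so maximality forces
  closedness. Conversely, choose \<open>z\<close> with all \<open>x @ z\<close> in the domain of
  \<open>f\<close>. An extension \<open>g\<close> agrees with \<open>f\<close> at these words, so
  every pair of \<open>g\<close> extends into \<open>f\<close> and lies in the closure of its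
  graph.\<close>

lemma maximal_isos_iff: "f \<in> maximal_isos n \<longleftrightarrow> big_iso (gr f) \<and> cl (gr f) = gr f"
proof
  assume f: "f \<in> maximal_isos n"
  then have b: "big_iso (gr f)" by (simp add: maximal_isos_def ideal_isos_iff)
  have g: "gr (fun_of (cl (gr f))) = cl (gr f)"
    using big_iso_cl[OF b] by (intro gr_fun_of) (simp add: big_iso_def)
  moreover have "gr f \<subseteq> cl (gr f)" using b cl_incl by (simp add: big_iso_def)
  ultimately have "fun_of (cl (gr f)) = f"
    using f big_iso_cl[OF b] unfolding maximal_isos_def by (simp add: ideal_isos_iff gr_le)
  then show "big_iso (gr f) \<and> cl (gr f) = gr f" using b g by simp
next
  assume f: "big_iso (gr f) \<and> cl (gr f) = gr f"
  have "g = f" if g: "big_iso (gr g)" "gr f \<subseteq> gr g" for g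
  proof -
    have ri: "rideal (gr g)" and pb: "pbij (gr g)" using g(1) by (simp_all add: big_iso_def)
    obtain z where z: "z \<in> W" "\<forall>x\<in>W. x @ z \<in> Range (gr f)"
      using long_extend f unfolding big_iso_def by blast
    have "(y @ z, x @ z) \<in> gr f" if yx: "(y, x) \<in> gr g" for y x
    proof -
      have "x \<in> W" using rideal_W[OF ri yx] by simp
      then obtain y' where y': "(y', x @ z) \<in> gr f" using z by blast
      have "(y @ z, x @ z) \<in> gr g" using rideal_app[OF ri yx z(1)] .
      then have "y' = y @ z" using y' g(2) pb unfolding pbij_iff by blast
      then show ?thesis using y' by simp
    qed
    then have "gr g \<subseteq> cl (gr f)" using subset_cl_iff[OF ri] z(1) by blast
    then show ?thesis using f g(2) gr_inj by auto
  qed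
  then show "f \<in> maximal_isos n"
    using f unfolding maximal_isos_def by (simp add: ideal_isos_iff gr_le)
qed

section \<open>Invertible elements of the model\<close>

lemma big_iso_converse: "big_iso (R\<inverse>) \<longleftrightarrow> big_iso R"
  unfolding big_iso_def using rideal_converse[of R] rideal_converse[of "R\<inverse>"]
  by (auto simp: pbij_converse)

lemma cl_converse: "cl (R\<inverse>) = (cl R)\<inverse>"
  unfolding cl_def by auto

lemma cl_long:
  assumes "long D" "D \<subseteq> W"
  shows "cl (Id_on D) = Id_on W"
proof
  show "cl (Id_on D) \<subseteq> Id_on W" using cl_mono[of "Id_on D" "Id_on W"] assms(2) cl_one by auto
  have "rideal (Id_on W)" using model_rideal[OF model_one] by simp
  then show "Id_on W \<subseteq> cl (Id_on D)" using long_extend[OF assms(1)] by (auto simp: subset_cl_iff)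
qed

text \<open>Finite generation is the issue. The pairs whose input word has length at most
  \<open>N\<close> generate \<open>R\<close>: a longer input word has its prefix of length
  \<open>N\<close> in the domain, and bijectivity identifies the output. They are finitely many
  because the input determines the output.\<close>

lemma big_iso_model:
  assumes "big_iso R" "cl R = R"
  shows "R \<in> carrier model"
proof -
  have ri: "rideal R" and pb: "pbij R" using assms(1) by (simp_all add: big_iso_def)
  obtain N where N: "\<forall>w\<in>W. N \<le> length w \<longrightarrow> w \<in> Range R"
    using assms(1) unfolding big_iso_def long_def by blast
  define F where "F = {(y, x). (y, x) \<in> R \<and> length x \<le> N}"
  have FR: "F \<subseteq> R" by (auto simp: F_def)
  have FW: "F \<subseteq> W \<times> W" using FR ri unfolding rideal_def by blast
  have "y = y'" if "(y, x) \<in> F" "(y', x) \<in> F" for y y' x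
    using that pb FR unfolding pbij_iff by blast
  then have "inj_on snd F" by (auto intro!: inj_onI)
  moreover have "snd ` F \<subseteq> {w. set w \<subseteq> {..<n} \<and> length w \<le> N}"
    using FW by (auto simp: F_def in_lists_conv_set)
  ultimately have fin: "finite F"
    using finite_lists_length_le[of "{..<n}" N] by (meson finite_lessThan inj_on_finite)
  have "R \<subseteq> gen F"
  proof clarify
    fix y x assume yx: "(y, x) \<in> R"
    show "(y, x) \<in> gen F"
    proof (cases "length x \<le> N")
      case True
      then show ?thesis using yx gen_incl[of F] by (auto simp: F_def)
    next
      case False
      have "take N x @ drop N x \<in> W" using rideal_W[OF ri yx] by simp
      then have W: "take N x \<in> W" "drop N x \<in> W" by (simp_all only: append_in_lists_conv)
      then obtain v where v: "(v, take N x) \<in> R" using N False by fastforce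
      have "(v @ drop N x, x) \<in> R" using rideal_app[OF ri v W(2)] by simp
      then have "y = v @ drop N x" using yx pb unfolding pbij_iff by blast
      moreover have "(v @ drop N x, take N x @ drop N x) \<in> gen F"
        using v W by (intro genI) (auto simp: F_def)
      ultimately show ?thesis by simp
    qed
  qed
  then have "gen F = R" using gen_least[OF ri FR] by blast
  then show ?thesis using modelI[OF fin FW] pb assms(2) by simp
qed

lemma big_iso_inverse:
  assumes "big_iso R"
  shows "cl (R O R\<inverse>) = Id_on W"
proof -
  have ri: "rideal R" and pb: "pbij R" using assms by (simp_all add: big_iso_def)
  have "R O R\<inverse> = Id_on (Domain R)" using pb unfolding pbij_iff by (auto simp: Id_on_iff)
  moreover have "Domain R \<subseteq> W" using ri unfolding rideal_def by blast
  ultimately show ?thesis using cl_long assms by (simp add: big_iso_def)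
qed

text \<open>If the product is \<open>1\<close>, every word \<open>x\<close> extends to an output of
  \<open>R\<close>, hence to an output of its finitely many generators, and
  \<open>dense_fg_long\<close> applies.\<close>

lemma unit_long:
  assumes "R \<in> carrier model" "cl (R O S) = Id_on W"
  shows "long (Domain R)"
proof -
  obtain F where F: "finite F" "F \<subseteq> W \<times> W" "R = cl (gen F)" using assms(1) by (auto elim: modelE)
  have dom: "Domain (gen F) = (\<Union>p\<in>fst ` F. (\<lambda>w. p @ w) ` W)"
    unfolding gen_def by force
  show ?thesis
  proof (rule dense_fg_long[of "fst ` F"])
    show "finite (fst ` F)" using F(1) by simp
    show "(\<Union>p\<in>fst ` F. (\<lambda>w. p @ w) ` W) \<subseteq> Domain R"
      unfolding dom[symmetric] F(3) using cl_incl[OF rideal_gen[OF F(2)]] by blast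
    fix x assume "x \<in> W"
    then have "(x, x) \<in> cl (R O S)" using assms(2) by auto
    then obtain z y where "(x @ z, y) \<in> cl (gen F)" using clD0 F(3) by blast
    then obtain z' where "(x @ z @ z', y @ z') \<in> gen F" using clD0 by fastforce
    then show "\<exists>z. x @ z \<in> (\<Union>p\<in>fst ` F. (\<lambda>w. p @ w) ` W)" unfolding dom[symmetric] by blast
  qed
qed

lemma model_converse: "R \<in> carrier model \<Longrightarrow> R\<inverse> \<in> carrier model"
proof (erule modelE)
  fix F assume "finite F" "F \<subseteq> W \<times> W" "pbij (gen F)" "R = cl (gen F)"
  then show ?thesis using modelI[of "F\<inverse>"] by (auto simp: gen_converse pbij_converse cl_converse)
qed

lemma Units_model: "R \<in> Units model \<longleftrightarrow> big_iso R \<and> cl R = R"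
proof
  assume "R \<in> Units model"
  then obtain S where R: "R \<in> carrier model" and S: "cl (R O S) = Id_on W" "cl (S O R) = Id_on W"
    unfolding Units_def by auto
  \<comment> \<open>Taking converses turns the left inverse \<open>S\<close> of \<open>R\<close>
    into a right inverse of \<open>R\<inverse>\<close>, so that \<open>unit_long\<close> also covers
    the input side of \<open>R\<close>.\<close>
  have "cl (R\<inverse> O S\<inverse>) = (cl (S O R))\<inverse>" by (simp add: cl_converse[symmetric] converse_relcomp)
  then have "cl (R\<inverse> O S\<inverse>) = Id_on W" using S(2) by simp
  then have "long (Domain (R\<inverse>))" by (rule unit_long[OF model_converse[OF R]])
  then show "big_iso R \<and> cl R = R"
    using unit_long[OF R S(1)] R by (simp add: big_iso_def model_rideal model_pbij model_cl)
next
  assume R: "big_iso R \<and> cl R = R"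
  then have C: "R \<in> carrier model" using big_iso_model by blast
  have "cl (R O R\<inverse>) = Id_on W" "cl (R\<inverse> O R) = Id_on W"
    using R big_iso_inverse[of R] big_iso_inverse[of "R\<inverse>"] by (simp_all add: big_iso_converse)
  then show "R \<in> Units model" using C model_converse[OF C] unfolding Units_def by auto
qed

lemma fun_of_units:
  assumes "R \<in> Units model"
  shows "gr (fun_of R) = R" "fun_of R \<in> maximal_isos n"
proof -
  have "big_iso R" "cl R = R" using assms Units_model by auto
  then show "gr (fun_of R) = R" by (simp add: gr_fun_of big_iso_def)
  with \<open>big_iso R\<close> \<open>cl R = R\<close> show "fun_of R \<in> maximal_isos n" by (simp add: maximal_isos_iff)
qed

text \<open>The closure of a composite is a maximal isomorphism extending it. Any maximal
  \<open>h\<close> extending the composite is closed, hence contains that closure, and maximality of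
  the closure gives equality. So the product of the Thompson group is the product of the
  model.\<close>

lemma units_thompson: "fun_of \<in> iso (units_of model) (thompson_group n)"
proof -
  interpret monoid model by (rule monoid_model)
  have "bij_betw fun_of (Units model) (maximal_isos n)"
  proof (rule bij_betw_byWitness[of _ gr])
    show "\<forall>R\<in>Units model. gr (fun_of R) = R" "fun_of ` Units model \<subseteq> maximal_isos n"
      using fun_of_units by auto
    show "\<forall>f\<in>maximal_isos n. fun_of (gr f) = f"
      by (simp add: maximal_isos_iff big_iso_def fun_of_gr)
    show "gr ` maximal_isos n \<subseteq> Units model"
      using Units_model maximal_isos_iff by blast
  qed
  moreover have "fun_of (cl (R O S)) = (THE h. h \<in> maximal_isos n \<and> (fun_of R \<circ>\<^sub>m fun_of S) \<subseteq>\<^sub>m h)"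
    if RS: "R \<in> Units model" "S \<in> Units model" for R S
  proof (rule the_equality[symmetric])
    have U: "cl (R O S) \<in> Units model" using Units_m_closed[OF RS] by simp
    note gU = fun_of_units[OF U]
    have "rideal (R O S)" using RS by (simp add: Units_model big_iso_def rideal_comp)
    then show "fun_of (cl (R O S)) \<in> maximal_isos n \<and> (fun_of R \<circ>\<^sub>m fun_of S) \<subseteq>\<^sub>m fun_of (cl (R O S))"
      using gU fun_of_units(1)[OF RS(1)] fun_of_units(1)[OF RS(2)] cl_incl by (simp add: gr_le gr_comp)
    fix h assume h: "h \<in> maximal_isos n \<and> (fun_of R \<circ>\<^sub>m fun_of S) \<subseteq>\<^sub>m h"
    then have "R O S \<subseteq> gr h"
      using fun_of_units(1)[OF RS(1)] fun_of_units(1)[OF RS(2)] by (simp add: gr_le gr_comp)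
    then have "cl (R O S) \<subseteq> gr h" using cl_mono h maximal_isos_iff by blast
    then have "fun_of (cl (R O S)) \<subseteq>\<^sub>m h" using gU(1) by (simp add: gr_le)
    then show "h = fun_of (cl (R O S))" using gU(2) h unfolding maximal_isos_def by blast
  qed
  ultimately show ?thesis
    unfolding iso_def hom_def
    by (auto simp: units_of_carrier units_of_mult thompson_group_def dest: bij_betwE)
qed

end

theorem theorem4p2:
  fixes n :: nat
  assumes "n \<ge> 2"
  shows "congruence_free (cuntz_monoid n) \<and>
         units_of (cuntz_monoid n) \<cong> thompson_group n"
proof -
  interpret polycyclic n by unfold_locales (rule assms)
  obtain h where h: "h \<in> iso model (cuntz_monoid n)" "h \<one>\<^bsub>model\<^esub> = \<one>\<^bsub>cuntz_monoid n\<^esub>"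
    using cuntz_iso by blast
  have "congruence_free (cuntz_monoid n)"
    by (rule congruence_free_iso[OF h(1) congruence_free_model model_closed])
  moreover have "units_of (cuntz_monoid n) \<cong> thompson_group n"
    using units_of_iso[OF h monoid_model] units_thompson iso_trans is_isoI by blast
  ultimately show ?thesis ..
qed

end
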